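(* Let $m\ge 3$, let $G(m)$ be a dihedral Artin group, and let $X=\{x,y\}$ be the free product generating set. Then $(G(m),X)$ satisfies the falsification by fellow traveler property (FFTP).
   Context: For $m\ge 3$, $G(m)=\langle a,b \mid {}_m(a,b)={}_m(b,a)\rangle$, where ${}_m(a,b)$ is the alternating word $abab\cdots$ of length $m$. Free product generating set $X=\{x,y\}$ (closed under inverses, so words in $X^*$ are over $\{x^{\pm1},y^{\pm1}\}$): for $m$ odd, $x={}_m(a,b)$, $y=ab$, giving $G(m)\cong\langle x,y\mid x^2=y^m\rangle$; for $m=2p$ even, $x=ab$, $y=a$, giving $G(m)\cong\langle x,y\mid y^{-1}x^py=x^p\rangle=\mathrm{BS}(p,p)$. Let $G=\langle X\rangle$ and $K\ge 0$. For a word $w$, $\mathrm{pre}_i(w)$ is its prefix of length $i$ (and is $w$ itself if $i$ is at least the length of $w$). Words $w,w'\in X^*$ $K$-fellow travel if $|\mathrm{pre}_i(w)^{-1}\mathrm{pre}_i(w')|\le K$ for every $i\ge 0$, where $|\cdot|$ is word length in $G$. The pair $(G,X)$ satisfies the FFTP if for some fixed constant $K$, every non-geodesic word $w\in X^*$ $K$-fellow travels with a shorter word representing the same element of $G$. *)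

theory Defs
  imports "HOL-Algebra.Generated_Groups"
begin

section \<open>Group presentations\<close>

text \<open>The letter \<open>(s, True)\<close> stands for the generator \<open>s\<close> and \<open>(s, False)\<close> for its formal
  inverse. A relation \<open>(u, v)\<close> stands for the equation \<open>u = v\<close>.\<close>

type_synonym 's letter = "'s \<times> bool"
type_synonym 's relations = "('s letter list \<times> 's letter list) set"

inductive pres_eq :: "'s relations \<Rightarrow> 's letter list \<Rightarrow> 's letter list \<Rightarrow> bool"
  for R :: "'s relations" where
  refl: "pres_eq R u u"
| sym: "pres_eq R u v \<Longrightarrow> pres_eq R v u"
| trans: "pres_eq R u v \<Longrightarrow> pres_eq R v w \<Longrightarrow> pres_eq R u w"
| cong: "pres_eq R u u' \<Longrightarrow> pres_eq R v v' \<Longrightarrow> pres_eq R (u @ v) (u' @ v')"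
| cancel: "pres_eq R [(s, e), (s, \<not> e)] []"
| rel: "(u, v) \<in> R \<Longrightarrow> pres_eq R u v"

definition pres_class :: "'s relations \<Rightarrow> 's letter list \<Rightarrow> 's letter list set" where
  "pres_class R u = {v. pres_eq R u v}"

text \<open>The generating set of the presentation is the whole type \<open>'s\<close>.\<close>

definition presented_group :: "'s relations \<Rightarrow> 's letter list set monoid" where
  "presented_group R =
    \<lparr>carrier = range (pres_class R),
     mult = (\<lambda>U V. \<Union>u\<in>U. \<Union>v\<in>V. pres_class R (u @ v)),
     one = pres_class R []\<rparr>"

lemma pres_class_eq_iff: "pres_class R u = pres_class R v \<longleftrightarrow> pres_eq R u v"
proof
  assume "pres_class R u = pres_class R v"
  moreover have "v \<in> pres_class R v"
    by (simp add: pres_class_def pres_eq.refl)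
  ultimately have "v \<in> pres_class R u" by simp
  then show "pres_eq R u v" by (simp add: pres_class_def)
next
  assume "pres_eq R u v"
  then show "pres_class R u = pres_class R v"
    unfolding pres_class_def by (blast intro: pres_eq.sym pres_eq.trans)
qed

lemma pres_class_mult:
  "pres_class R u \<otimes>\<^bsub>presented_group R\<^esub> pres_class R v = pres_class R (u @ v)"
proof -
  have eq: "pres_class R (u' @ v') = pres_class R (u @ v)"
    if "u' \<in> pres_class R u" "v' \<in> pres_class R v" for u' v'
  proof -
    have "pres_eq R u u'" "pres_eq R v v'"
      using that by (simp_all add: pres_class_def)
    then have "pres_eq R (u' @ v') (u @ v)"
      by (intro pres_eq.sym[OF pres_eq.cong])
    then show ?thesis by (simp add: pres_class_eq_iff)
  qed
  have "u \<in> pres_class R u" "v \<in> pres_class R v"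
    by (simp_all add: pres_class_def pres_eq.refl)
  then have "(\<Union>u'\<in>pres_class R u. \<Union>v'\<in>pres_class R v. pres_class R (u' @ v'))
      = pres_class R (u @ v)"
    using eq by blast
  then show ?thesis
    by (simp add: presented_group_def)
qed

lemma pres_class_carrier [simp]: "pres_class R u \<in> carrier (presented_group R)"
  by (simp add: presented_group_def)

lemma pres_class_one: "\<one>\<^bsub>presented_group R\<^esub> = pres_class R []"
  by (simp add: presented_group_def)

lemma carrier_presented_group: "carrier (presented_group R) = range (pres_class R)"
  by (simp add: presented_group_def)

definition inv_word :: "'s letter list \<Rightarrow> 's letter list" where
  "inv_word u = rev (map (\<lambda>(s, e). (s, \<not> e)) u)"

lemma pres_eq_inv_word: "pres_eq R (inv_word u @ u) []"
proof (induction u)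
  case Nil
  show ?case by (simp add: inv_word_def pres_eq.refl)
next
  case (Cons l u)
  obtain s e where l: "l = (s, e)" by (cases l)
  have "pres_eq R [(s, \<not> e), (s, e)] []"
    using pres_eq.cancel[of R s "\<not> e"] by simp
  then have "pres_eq R ([(s, \<not> e), (s, e)] @ u) ([] @ u)"
    by (rule pres_eq.cong[OF _ pres_eq.refl])
  then have "pres_eq R (inv_word u @ ([(s, \<not> e), (s, e)] @ u)) (inv_word u @ ([] @ u))"
    by (rule pres_eq.cong[OF pres_eq.refl])
  then have "pres_eq R (inv_word u @ ([(s, \<not> e), (s, e)] @ u)) []"
    using Cons by (simp only: append_Nil) (rule pres_eq.trans)
  then show ?case
    by (simp add: inv_word_def l)
qed

lemma group_presented_group: "group (presented_group R)"
proof (rule groupI)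
  fix g assume "g \<in> carrier (presented_group R)"
  then obtain u where g: "g = pres_class R u" by (auto simp: carrier_presented_group)
  show "\<exists>h\<in>carrier (presented_group R). h \<otimes>\<^bsub>presented_group R\<^esub> g = \<one>\<^bsub>presented_group R\<^esub>"
    by (rule bexI[of _ "pres_class R (inv_word u)"])
       (simp_all add: g pres_class_mult pres_class_one pres_class_eq_iff pres_eq_inv_word)
qed (auto simp: carrier_presented_group pres_class_mult pres_class_one)

lemma pres_class_inv:
  "inv\<^bsub>presented_group R\<^esub> (pres_class R u) = pres_class R (inv_word u)"
proof -
  interpret group "presented_group R" by (rule group_presented_group)
  show ?thesis
    by (rule inv_equality)
       (simp_all add: pres_class_mult pres_class_one pres_class_eq_iff pres_eq_inv_word)
qed


section \<open>Dihedral Artin groups and the free product generating set\<close>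

datatype artin_gen = GenA | GenB

abbreviation letter_a :: "artin_gen letter" where "letter_a \<equiv> (GenA, True)"
abbreviation letter_b :: "artin_gen letter" where "letter_b \<equiv> (GenB, True)"

text \<open>\<open>alternating m s t\<close> is the alternating word \<open>s t s t \<dots>\<close> of length \<open>m\<close>.\<close>

fun alternating :: "nat \<Rightarrow> 'l \<Rightarrow> 'l \<Rightarrow> 'l list" where
  "alternating 0 s t = []"
| "alternating (Suc m) s t = s # alternating m t s"

definition artin_relations :: "nat \<Rightarrow> artin_gen relations" where
  "artin_relations m = {(alternating m letter_a letter_b, alternating m letter_b letter_a)}"

definition dihedral_artin :: "nat \<Rightarrow> artin_gen letter list set monoid" where
  "dihedral_artin m = presented_group (artin_relations m)"

definition gen_x :: "nat \<Rightarrow> artin_gen letter list set" where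
  "gen_x m = pres_class (artin_relations m)
     (if odd m then alternating m letter_a letter_b else [letter_a, letter_b])"

definition gen_y :: "nat \<Rightarrow> artin_gen letter list set" where
  "gen_y m = pres_class (artin_relations m)
     (if odd m then [letter_a, letter_b] else [letter_a])"

definition free_product_gens :: "nat \<Rightarrow> artin_gen letter list set set" where
  "free_product_gens m = {gen_x m, gen_y m}"


section \<open>The falsification by fellow traveler property\<close>

text \<open>Words over \<open>X \<union> X\<^sup>-\<^sup>1\<close>; letters are elements of the group.\<close>

definition words_over :: "('g, 'm) monoid_scheme \<Rightarrow> 'g set \<Rightarrow> 'g list set" where
  "words_over G X = lists (X \<union> m_inv G ` X)"

definition word_eval :: "('g, 'm) monoid_scheme \<Rightarrow> 'g list \<Rightarrow> 'g" where
  "word_eval G w = foldr (mult G) w \<one>\<^bsub>G\<^esub>"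

definition word_length :: "('g, 'm) monoid_scheme \<Rightarrow> 'g set \<Rightarrow> 'g \<Rightarrow> nat" where
  "word_length G X g = (LEAST n. \<exists>w\<in>words_over G X. word_eval G w = g \<and> length w = n)"

definition geodesic_word :: "('g, 'm) monoid_scheme \<Rightarrow> 'g set \<Rightarrow> 'g list \<Rightarrow> bool" where
  "geodesic_word G X w \<longleftrightarrow>
     w \<in> words_over G X \<and> length w = word_length G X (word_eval G w)"

definition fellow_travel ::
  "('g, 'm) monoid_scheme \<Rightarrow> 'g set \<Rightarrow> nat \<Rightarrow> 'g list \<Rightarrow> 'g list \<Rightarrow> bool" where
  "fellow_travel G X K w w' \<longleftrightarrow>
     (\<forall>i. word_length G X
            (inv\<^bsub>G\<^esub> (word_eval G (take i w)) \<otimes>\<^bsub>G\<^esub> word_eval G (take i w')) \<le> K)"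

text \<open>Meaningful for a group \<open>G\<close> generated by \<open>X\<close>; for the groups above see
  \<open>group_dihedral_artin\<close> and \<open>generate_free_product_gens\<close> below.\<close>

definition fftp :: "('g, 'm) monoid_scheme \<Rightarrow> 'g set \<Rightarrow> bool" where
  "fftp G X \<longleftrightarrow>
     (\<exists>K. \<forall>w\<in>words_over G X. \<not> geodesic_word G X w \<longrightarrow>
        (\<exists>w'\<in>words_over G X. length w' < length w \<and> word_eval G w' = word_eval G w
            \<and> fellow_travel G X K w w'))"


section \<open>The free product generating set generates\<close>

lemma group_dihedral_artin: "group (dihedral_artin m)"
  unfolding dihedral_artin_def by (rule group_presented_group)

lemma free_product_gens_carrier: "free_product_gens m \<subseteq> carrier (dihedral_artin m)"
  by (simp add: free_product_gens_def gen_x_def gen_y_def dihedral_artin_def)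

lemma alternating_odd: "alternating (Suc (2 * k)) s t = concat (replicate k [s, t]) @ [s]"
  by (induction k) simp_all

lemma generate_free_product_gens:
  "generate (dihedral_artin m) (free_product_gens m) = carrier (dihedral_artin m)"
proof -
  interpret group "dihedral_artin m" by (rule group_dihedral_artin)
  define cl where "cl = pres_class (artin_relations m)"
  define H where "H = generate (dihedral_artin m) (free_product_gens m)"
  have H: "subgroup H (dihedral_artin m)"
    unfolding H_def by (rule generate_is_subgroup[OF free_product_gens_carrier])
  have mult: "cl u \<otimes>\<^bsub>dihedral_artin m\<^esub> cl v = cl (u @ v)" for u v
    by (simp add: cl_def dihedral_artin_def pres_class_mult)
  have one: "cl [] = \<one>\<^bsub>dihedral_artin m\<^esub>"
    by (simp add: cl_def dihedral_artin_def pres_class_one)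
  have clC: "cl u \<in> carrier (dihedral_artin m)" for u
    by (simp add: cl_def dihedral_artin_def)
  have app: "cl (u @ v) \<in> H" if "cl u \<in> H" "cl v \<in> H" for u v
    using subgroup.m_closed[OF H that] by (simp add: mult)
  have cancelH: "cl v \<in> H" if "cl u \<in> H" "cl (u @ v) \<in> H" for u v
  proof -
    have "inv\<^bsub>dihedral_artin m\<^esub> cl u \<otimes>\<^bsub>dihedral_artin m\<^esub> cl (u @ v) \<in> H"
      using subgroup.m_closed[OF H subgroup.m_inv_closed[OF H that(1)] that(2)] .
    then show ?thesis
      by (simp add: mult[symmetric] m_assoc[symmetric] clC)
  qed
  have x: "gen_x m \<in> H" and y: "gen_y m \<in> H"
    by (auto simp: H_def free_product_gens_def intro: generate.incl)
  have ab: "cl [letter_a, letter_b] \<in> H"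
    using x y by (cases "odd m") (simp_all add: gen_x_def gen_y_def cl_def)
  have a: "cl [letter_a] \<in> H"
  proof (cases "odd m")
    case True
    then obtain k where k: "m = Suc (2 * k)" by (metis oddE Suc_eq_plus1)
    have "cl (concat (replicate k [letter_a, letter_b])) \<in> H"
      by (induction k) (use app[OF ab] in \<open>simp_all add: one subgroup.one_closed[OF H]\<close>)
    moreover have "cl (concat (replicate k [letter_a, letter_b]) @ [letter_a]) \<in> H"
      using x True unfolding gen_x_def cl_def k by (simp only: alternating_odd if_True not_False_eq_True)
    ultimately show ?thesis by (rule cancelH)
  next
    case False
    with y show ?thesis by (simp add: gen_y_def cl_def)
  qed
  have b: "cl [letter_b] \<in> H"
    using cancelH[OF a, of "[letter_b]"] ab by simp
  have letter: "cl [l] \<in> H" for l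
  proof -
    obtain s e where l: "l = (s, e)" by (cases l)
    have pos: "cl [(s, True)] \<in> H" using a b by (cases s) simp_all
    have "inv\<^bsub>dihedral_artin m\<^esub> cl [(s, True)] = cl [(s, False)]"
      by (simp add: cl_def dihedral_artin_def pres_class_inv inv_word_def)
    with subgroup.m_inv_closed[OF H pos] have "cl [(s, False)] \<in> H" by simp
    with pos show ?thesis by (cases e) (simp_all add: l)
  qed
  have "cl u \<in> H" for u
  proof (induction u)
    case Nil
    show ?case by (simp add: one subgroup.one_closed[OF H])
  next
    case (Cons l u)
    then show ?case using app[OF letter[of l]] by simp
  qed
  then have "carrier (dihedral_artin m) \<subseteq> H"
    by (auto simp: cl_def dihedral_artin_def carrier_presented_group)
  with subgroup.subset[OF H] show ?thesis by (simp add: H_def)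
qed

end

theory Submission
  imports Defs "HOL-Library.Sublist"
begin

text \<open>Put \<open>p = 2\<close>, \<open>q = m\<close> for odd \<open>m\<close> and \<open>p = m/2\<close>, \<open>q = \<infinity>\<close> for even \<open>m\<close>. The element
  \<open>\<Delta> = x\<^sup>p\<close>, which equals \<open>y\<^sup>q\<close> if \<open>q\<close> is finite, is central, and modulo \<open>\<Delta>\<close> the group is the free product of cyclic groups of
  orders \<open>p\<close> and \<open>q\<close>. An element is a reduced sequence of syllables together with an exponent of
  \<open>\<Delta>\<close>, so finding a shortest word for it means distributing the exponent over the syllables, each of
  which has a convex cost. By duality with a slope \<open>\<kappa>\<close>, \<open>\<bar>\<kappa>\<bar> \<le> p\<close>, a word without \<open>x\<^sup>p\<close>, \<open>x\<^sup>-\<^sup>p\<close> is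
  geodesic as soon as it is freely reduced and each run \<open>g\<^sup>b\<close> satisfies \<open>2b \<le> n \<plusminus> \<kappa>\<close>, where
  \<open>n\<close> is the order of \<open>g\<close> and the sign is that of the run: the height function with slope \<open>\<kappa>\<close> is
  1-Lipschitz and attains the length. If no slope works, two runs conflict, and replacing \<open>g\<^sup>b\<close> by
  \<open>g\<^sup>b\<^sup>-\<^sup>n\<close> in both (and symmetrically for negative runs) shortens the word; between them the
  prefixes differ by \<open>\<Delta>\<close> only, so the words fellow travel. Occurrences of \<open>x\<^sup>p\<close> are deleted
  first, which forces \<open>\<kappa> = \<plusminus>p\<close>; a run interspersed with such blocks stays close to the powers of \<open>x\<close>.\<close>

section \<open>Normal forms and height functions\<close>

definition sg :: "bool \<Rightarrow> int" where
  "sg s = (if s then 1 else - 1)"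

text \<open>A state is a pair of a syllable list, last syllable first, and an exponent of the central
  element; \<open>N g = 0\<close> means that \<open>g\<close> has infinite order, consistently with \<open>k div 0 = 0\<close> and
  \<open>k mod 0 = k\<close>.\<close>

fun res :: "'g \<Rightarrow> ('g \<times> int) list \<Rightarrow> int" where
  "res g [] = 0"
| "res g ((h, r) # st) = (if h = g then r else 0)"

fun rest :: "'g \<Rightarrow> ('g \<times> int) list \<Rightarrow> ('g \<times> int) list" where
  "rest g [] = []"
| "rest g ((h, r) # st) = (if h = g then st else (h, r) # st)"

definition push :: "'g \<Rightarrow> int \<Rightarrow> ('g \<times> int) list \<Rightarrow> ('g \<times> int) list" where
  "push g k st = (if k = 0 then st else (g, k) # st)"

text \<open>As the residues of a valid list are nonzero, \<open>res g st = 0\<close> says that the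
  syllable before \<open>(g, r)\<close> belongs to a different generator. For \<open>N g = 0\<close>
  the \<open>mod\<close> condition always holds.\<close>

fun valid :: "('g \<Rightarrow> nat) \<Rightarrow> ('g \<times> int) list \<Rightarrow> bool" where
  "valid N [] = True"
| "valid N ((g, r) # st) \<longleftrightarrow> r \<noteq> 0 \<and> r mod int (N g) = r \<and> res g st = 0 \<and> valid N st"

lemma rest_eq: "valid N st \<Longrightarrow> res g st = 0 \<Longrightarrow> rest g st = st"
  by (cases "(N, st)" rule: valid.cases) (auto split: if_splits)

lemma res_push: "res g st = 0 \<Longrightarrow> res g (push g k st) = k"
  by (simp add: push_def)

lemma rest_push: "valid N st \<Longrightarrow> res g st = 0 \<Longrightarrow> rest g (push g k st) = st"
  by (simp add: push_def rest_eq)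

lemma push_res_rest: "valid N st \<Longrightarrow> push g (res g st) (rest g st) = st"
  by (cases "(N, st)" rule: valid.cases) (auto simp: push_def)

lemma valid_rest: "valid N st \<Longrightarrow> valid N (rest g st)"
  by (cases "(N, st)" rule: valid.cases) auto

lemma res_rest: "valid N st \<Longrightarrow> res g (rest g st) = 0"
  by (cases "(N, st)" rule: valid.cases) auto

lemma res_mod: "valid N st \<Longrightarrow> res g st mod int (N g) = res g st"
  by (cases "(N, st)" rule: valid.cases) auto

lemma valid_push:
  "valid N st \<Longrightarrow> res g st = 0 \<Longrightarrow> valid N (push g (k mod int (N g)) st)"
  by (simp add: push_def)

text \<open>Right multiplication of a normal form by g^n: the exponent merges with the top syllable,
  and full orders are carried into the central exponent.\<close>

definition run :: "('g \<Rightarrow> nat) \<Rightarrow> 'g \<Rightarrow> int \<Rightarrow> ('g \<times> int) list \<times> int \<Rightarrow> ('g \<times> int) list \<times> int" where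
  "run N g n S = (let k = res g (fst S) + n in
     (push g (k mod int (N g)) (rest g (fst S)), snd S + k div int (N g)))"

lemma valid_run: "valid N (fst S) \<Longrightarrow> valid N (fst (run N g n S))"
  by (simp add: run_def Let_def valid_push valid_rest res_rest)

lemma run_run:
  assumes "valid N (fst S)"
  shows "run N g n' (run N g n S) = run N g (n + n') S"
proof -
  have "a div b + (a mod b + n') div b = (a + n') div b" for a b :: int
  proof (cases "b = 0")
    case False
    have "a + n' = (a mod b + n') + (a div b) * b"
      by (simp add: algebra_simps)
    with False show ?thesis by (metis div_mult_self1)
  qed simp
  then show ?thesis
    using assms
    by (simp add: run_def Let_def res_push res_rest valid_rest rest_push[where N = N] mod_simps
        add.assoc)
qed

lemma res_div: "valid N st \<Longrightarrow> res g st div int (N g) = 0"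
  by (metis res_mod mod_div_trivial)

lemma run_0: "valid N (fst S) \<Longrightarrow> run N g 0 S = S"
  by (simp add: run_def push_res_rest res_mod res_div)

lemma run_order:
  assumes "valid N (fst S)" "N g \<noteq> 0"
  shows "run N g (int (N g) * j) S = (fst S, snd S + j)"
  using assms by (simp add: run_def push_res_rest res_mod res_div)

lemma run_shift: "run N g n (st, c + d) = (fst (run N g n (st, c)), snd (run N g n (st, c)) + d)"
  by (simp add: run_def Let_def)

section \<open>Right action of words on states\<close>

definition step :: "('g \<Rightarrow> nat) \<Rightarrow> ('g \<times> int) list \<times> int \<Rightarrow> 'g letter \<Rightarrow> ('g \<times> int) list \<times> int" where
  "step N S l = run N (fst l) (sg (snd l)) S"

abbreviation "steps N \<equiv> foldl (step N)"

lemma valid_steps: "valid N (fst S) \<Longrightarrow> valid N (fst (steps N S w))"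
  by (induction w arbitrary: S) (simp_all add: step_def valid_run)

lemma steps_replicate:
  "valid N (fst S) \<Longrightarrow> steps N S (replicate n (g, s)) = run N g (sg s * int n) S"
  by (induction n arbitrary: S) (simp_all add: run_0 run_run valid_run step_def algebra_simps)

lemma inv_word_Nil [simp]: "inv_word [] = []"
  and inv_word_append: "inv_word (u @ v) = inv_word v @ inv_word u"
  and inv_word_inv_word [simp]: "inv_word (inv_word u) = u"
  and length_inv_word [simp]: "length (inv_word u) = length u"
  and inv_word_replicate [simp]: "inv_word (replicate n (g, s)) = replicate n (g, \<not> s)"
  by (auto simp: inv_word_def rev_map comp_def case_prod_beta)

lemma steps_inv_word:
  "valid N (fst S) \<Longrightarrow> steps N S (w @ inv_word w) = S"
proof (induction w arbitrary: S)
  case (Cons l w)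
  have "inv_word (l # w) = inv_word w @ [(fst l, \<not> snd l)]"
    by (simp add: inv_word_def case_prod_beta)
  with Cons show ?case
    by (simp add: step_def valid_run run_run run_0 sg_def)
qed simp

text \<open>The weight is the minimum over \<open>j\<close> of the cost \<open>\<bar>r + jn\<bar>\<close> minus \<open>\<kappa>j\<close>, where \<open>n\<close> is the order; as
  \<open>\<bar>\<kappa>\<bar> \<le> n\<close>, it is attained at \<open>j = 0\<close> or \<open>j = - 1\<close>.\<close>

definition weight :: "('g \<Rightarrow> nat) \<Rightarrow> int \<Rightarrow> 'g \<Rightarrow> int \<Rightarrow> int" where
  "weight N \<kappa> g r = (if N g = 0 then \<bar>r\<bar> else min r (int (N g) - r + \<kappa>))"

section \<open>Height functions of a given slope\<close>

definition height :: "('g \<Rightarrow> nat) \<Rightarrow> int \<Rightarrow> ('g \<times> int) list \<times> int \<Rightarrow> int" where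
  "height N \<kappa> S = \<kappa> * snd S + (\<Sum>(g, r)\<leftarrow>fst S. weight N \<kappa> g r)"

text \<open>Contribution to the height of a run with total exponent \<open>k\<close>, carry
  included.\<close>

definition gain :: "('g \<Rightarrow> nat) \<Rightarrow> int \<Rightarrow> 'g \<Rightarrow> int \<Rightarrow> int" where
  "gain N \<kappa> g k = \<kappa> * (k div int (N g)) + weight N \<kappa> g (k mod int (N g))"

text \<open>The hypothesis gives \<open>weight N \<kappa> g 0 = 0\<close>, so a syllable omitted by
  \<open>push\<close> contributes nothing.\<close>

lemma height_push:
  assumes "N g = 0 \<or> - int (N g) \<le> \<kappa>"
  shows "height N \<kappa> (push g k st, c) = height N \<kappa> (st, c) + weight N \<kappa> g k"
  using assms by (auto simp: height_def push_def weight_def)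

lemma height_run:
  assumes "N g = 0 \<or> - int (N g) \<le> \<kappa>"
  shows "height N \<kappa> (run N g n S) = height N \<kappa> (rest g (fst S), snd S) + gain N \<kappa> g (res g (fst S) + n)"
  using assms unfolding run_def Let_def
  by (simp add: height_push) (simp add: height_def gain_def algebra_simps)

lemma gain_pos:
  assumes "0 < k" "N g = 0 \<or> k < int (N g) \<and> 2 * k \<le> int (N g) + \<kappa>"
  shows "gain N \<kappa> g k = k"
  using assms by (auto simp: gain_def weight_def)

text \<open>For finite order the carry is - 1 and the remainder \<open>N g - k\<close>; the bound
  selects the second term of the minimum in \<open>weight\<close>, whose \<kappa> cancels that of
  the carry.\<close>

lemma gain_neg:
  assumes "0 < k" "N g = 0 \<or> k < int (N g) \<and> 2 * k \<le> int (N g) - \<kappa>"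
  shows "gain N \<kappa> g (- k) = k"
proof (cases "N g = 0")
  case False
  have "(- k) div int (N g) = - 1" "(- k) mod int (N g) = int (N g) - k"
    using assms False
      int_div_pos_eq[of "- k" "int (N g)" "- 1" "int (N g) - k"]
      int_mod_pos_eq[of "- k" "int (N g)" "- 1" "int (N g) - k"] by auto
  with False assms show ?thesis by (simp add: gain_def weight_def)
qed (use assms in \<open>simp add: gain_def weight_def\<close>)

text \<open>Between carries, \<open>weight\<close> is a minimum of functions of slopes 1 and - 1; at
  a carry, the bound on \<kappa> keeps the change within 1.\<close>

lemma gain_succ:
  assumes "N g = 0 \<or> \<bar>\<kappa>\<bar> \<le> int (N g)"
  shows "\<bar>gain N \<kappa> g (k + 1) - gain N \<kappa> g k\<bar> \<le> 1"
proof (cases "N g = 0")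
  case False
  define d r where "d = k div int (N g)" and "r = k mod int (N g)"
  have k: "k = int (N g) * d + r" and r: "0 \<le> r" "r < int (N g)"
    using False by (simp_all add: d_def r_def)
  show ?thesis
  proof (cases "r + 1 = int (N g)")
    case True
    then have "(k + 1) div int (N g) = d + 1" "(k + 1) mod int (N g) = 0"
      using False k r int_div_pos_eq[of "k + 1" "int (N g)" "d + 1" 0]
        int_mod_pos_eq[of "k + 1" "int (N g)" "d + 1" 0] by (simp_all add: algebra_simps)
    with True False assms r show ?thesis
      unfolding gain_def d_def[symmetric] r_def[symmetric]
      by (auto simp: weight_def algebra_simps min_def abs_if split: if_splits)
  next
    case neq: False
    then have "(k + 1) div int (N g) = d" "(k + 1) mod int (N g) = r + 1"
      using neq k r int_div_pos_eq[of "k + 1" "int (N g)" d "r + 1"]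
        int_mod_pos_eq[of "k + 1" "int (N g)" d "r + 1"] by (simp_all add: algebra_simps)
    with False assms r show ?thesis
      unfolding gain_def d_def[symmetric] r_def[symmetric]
      by (auto simp: weight_def algebra_simps min_def abs_if split: if_splits)
  qed
qed (simp add: gain_def weight_def)

lemma height_step:
  assumes v: "valid N (fst S)" and l: "\<And>g. N g = 0 \<or> \<bar>\<kappa>\<bar> \<le> int (N g)"
  shows "height N \<kappa> (step N S l) \<le> height N \<kappa> S + 1"
proof -
  obtain g s where gs: "l = (g, s)" by (cases l)
  have l': "N g = 0 \<or> - int (N g) \<le> \<kappa>" using l[of g] by auto
  \<comment> \<open>Viewing \<open>S\<close> as its own run by 0 expresses both heights through
    \<open>gain\<close>, at exponents differing by one.\<close>
  have "height N \<kappa> (run N g 0 S) = height N \<kappa> S"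
    by (simp add: run_0 v)
  moreover note height_run[of N g \<kappa> 0 S, OF l'] height_run[of N g \<kappa> "sg s" S, OF l']
    gain_succ[of N g \<kappa> "res g (fst S)", OF l] gain_succ[of N g \<kappa> "res g (fst S) - 1", OF l]
  ultimately show ?thesis
    by (simp add: gs step_def sg_def split: if_splits)
qed

lemma height_steps:
  assumes "valid N (fst S)" and l: "\<And>g. N g = 0 \<or> \<bar>\<kappa>\<bar> \<le> int (N g)"
  shows "height N \<kappa> (steps N S w) \<le> height N \<kappa> S + int (length w)"
  using assms(1)
proof (induction w arbitrary: S)
  case (Cons a w)
  have "valid N (fst (step N S a))"
    using Cons.prems by (simp add: step_def valid_run)
  from Cons.IH[OF this] height_step[OF Cons.prems l, of a] show ?case
    by simp
qed simp

lemma mod_ne_0: 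
  assumes "0 < b" "N = 0 \<or> b < N"
  shows "(sg s * int b) mod int N \<noteq> 0"
proof
  assume "(sg s * int b) mod int N = 0"
  then have "int N dvd int b"
    by (auto simp: sg_def split: if_splits)
  then have "N dvd b" by simp
  with assms show False by (auto dest: dvd_imp_le)
qed

lemma steps_snoc: "steps N S (w @ [(g, s)]) = run N g (sg s) (steps N S w)"
  unfolding step_def by simp

text \<open>Each run has gain equal to its length, so heights add up run by run. With
  \<open>height_steps\<close> this makes \<open>w\<close> a shortest word for its state.\<close>

lemma height_tight:
  assumes slope: "\<And>g. N g = 0 \<or> \<bar>\<kappa>\<bar> \<le> int (N g)"
    and red: "\<And>g s. \<not> sublist [(g, s), (g, \<not> s)] w"
    and short: "\<And>g s b. N g \<noteq> 0 \<Longrightarrow> sublist (replicate b (g, s)) w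
      \<Longrightarrow> b < N g \<and> 2 * int b \<le> int (N g) + sg s * \<kappa>"
  shows "height N \<kappa> (steps N ([], 0) w) = int (length w)"
proof -
  have tight: "height N \<kappa> (run N g (sg s * int b) (st, c)) = height N \<kappa> (st, c) + int b"
    if "0 < b" "valid N st" "res g st = 0" "sublist (replicate b (g, s)) w" for b g s st c
  proof -
    have "gain N \<kappa> g (sg s * int b) = int b"
      using that short[of g b s] gain_pos[of "int b" N g \<kappa>] gain_neg[of "int b" N g \<kappa>]
      by (cases s; cases "N g = 0") (auto simp: sg_def)
    moreover have "N g = 0 \<or> - int (N g) \<le> \<kappa>"
      using slope[of g] by auto
    ultimately show ?thesis
      using that by (simp add: height_run rest_eq)
  qed
  \<comment> \<open>The induction exposes the last run and the state before it, because a further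
    letter of that run changes the gain of the whole syllable.\<close>
  have "height N \<kappa> (steps N ([], 0) v) = int (length v) \<and>
    (v = [] \<or> (\<exists>u b g s st c. v = u @ replicate (Suc b) (g, s) \<and> valid N st \<and> res g st = 0 \<and>
      steps N ([], 0) v = run N g (sg s * int (Suc b)) (st, c) \<and>
      height N \<kappa> (st, c) = int (length u)))" if "prefix v w" for v
    using that
  proof (induction v rule: rev_induct)
    case Nil
    show ?case by (simp add: height_def)
  next
    case (snoc l v)
    obtain g s where l: "l = (g, s)" by (cases l)
    have vw: "prefix v w" using snoc.prems by (rule append_prefixD)
    have sub: "sublist y w" if "v @ [l] = x @ y" for x y
      using that snoc.prems by (metis prefix_imp_sublist sublist_append_leftI sublist_order.order.trans)
    have val: "valid N (fst (steps N ([], 0) v))"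
      by (rule valid_steps) simp
    show ?case
    proof (cases "v = [] \<or> fst (last v) \<noteq> g")
      case True
      let ?S = "steps N ([], 0) v"
      have res: "res g (fst ?S) = 0"
      proof (cases "v = []")
        case False
        then obtain u b h t st c where v: "v = u @ replicate (Suc b) (h, t)" "valid N st" "res h st = 0"
          "?S = run N h (sg t * int (Suc b)) (st, c)"
          using snoc.IH[OF vw] by blast
        have "sublist (replicate (Suc b) (h, t)) w"
          using v(1) vw by (metis prefix_imp_sublist sublist_append_leftI sublist_order.order.trans)
        then have "N h = 0 \<or> Suc b < N h"
          using short by blast
        \<comment> \<open>The last run leaves a nonzero residue, so \<open>h\<close> is on top and
          \<open>g\<close> meets residue 0.\<close>
        then have "(sg t * int (Suc b)) mod int (N h) \<noteq> 0"
          by (rule mod_ne_0[rotated]) simp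
        moreover have "h \<noteq> g" using True False v(1) by (simp add: replicate_append_same[symmetric] del: replicate_Suc)
        ultimately show ?thesis using v(2-) by (simp add: run_def push_def Let_def)
      qed simp
      have "sublist (replicate 1 (g, s)) w" using sub[of v "[l]"] l by simp
      from tight[OF _ val res this, of "snd ?S"] snoc.IH[OF vw]
      have "height N \<kappa> (steps N ([], 0) (v @ [l])) = int (length (v @ [l]))"
        by (simp add: l steps_snoc del: foldl_append)
      moreover have "v @ [l] = v @ replicate (Suc 0) (g, s)"
        "steps N ([], 0) (v @ [l]) = run N g (sg s * int (Suc 0)) (fst ?S, snd ?S)"
        "height N \<kappa> (fst ?S, snd ?S) = int (length v)"
        using snoc.IH[OF vw] by (simp_all add: l steps_snoc del: foldl_append)
      ultimately show ?thesis using val res by blast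
    next
      case False
      then obtain u b h t st c where v: "v = u @ replicate (Suc b) (h, t)" "valid N st" "res h st = 0"
        "steps N ([], 0) v = run N h (sg t * int (Suc b)) (st, c)" "height N \<kappa> (st, c) = int (length u)"
        using snoc.IH[OF vw] by blast
      have h: "h = g" using False v(1) by (simp add: replicate_append_same[symmetric] del: replicate_Suc)
      have "t = s"
      proof (rule ccontr)
        assume "t \<noteq> s"
        then have "sublist [(g, t), (g, \<not> t)] w"
          using sub[of "u @ replicate b (h, t)" "[(h, t), l]"] v(1) h l
          by (simp add: replicate_append_same[symmetric])
        with red show False by blast
      qed
      have e: "v @ [l] = u @ replicate (Suc (Suc b)) (g, s)"
        using v(1) h l \<open>t = s\<close> by (simp add: replicate_append_same)
      have st: "steps N ([], 0) (v @ [l]) = run N g (sg s * int (Suc (Suc b))) (st, c)"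
        using v(2,4) h l \<open>t = s\<close> by (simp add: steps_snoc run_run algebra_simps del: foldl_append)
      with tight[of "Suc (Suc b)" st g s c] sub[OF e] v(2,3,5) h e
      have "height N \<kappa> (steps N ([], 0) (v @ [l])) = int (length (v @ [l]))"
        by simp
      with e st v(2,3,5) h show ?thesis by blast
    qed
  qed
  then show ?thesis by blast
qed

section \<open>Fellow traveling up to central elements\<close>

datatype xy = GenX | GenY

text \<open>A run of \<open>a\<close> cannot cross \<open>z\<close>. This preserves a positive run
  while a negative one is being replaced.\<close>

lemma sublist_replicate_split:
  assumes "sublist (replicate n a) (u @ z @ v)" "z \<noteq> []" "a \<notin> set z"
  shows "sublist (replicate n a) u \<or> sublist (replicate n a) v"
proof -
  have Cons: "sublist (replicate n a) v" if "sublist (replicate n a) (x # v)" "x \<noteq> a" for x v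
    using that by (cases n) (auto simp: sublist_Cons_right)
  have skip: "sublist (replicate n a) v" if "sublist (replicate n a) (z @ v)" "a \<notin> set z" for z
    using that by (induction z) (auto dest: Cons)
  obtain x z' where z: "z = x # z'" "x \<noteq> a" "a \<notin> set z'"
    using assms(2,3) by (cases z) auto
  from assms(1) consider "sublist (replicate n a) u" | "sublist (replicate n a) (z @ v)"
    | r t where "replicate n a = r @ t" "suffix r u" "prefix t (z @ v)"
    by (auto simp: sublist_append[of _ u])
  then show ?thesis
  proof cases
    case 3
    have "t = []"
    proof (cases t)
      case (Cons y t')
      with 3(3) z have "y = x" by simp
      moreover have "y \<in> set (replicate n a)" using 3(1) Cons by simp
      ultimately show ?thesis using z(2) by simp
    qed
    with 3 show ?thesis by (auto intro: suffix_imp_sublist)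
  qed (use skip assms(3) in blast)+
qed

text \<open>\<open>E\<close> is equality in the group of words in x and y; \<open>E_steps\<close>
  makes the state an invariant of the group element. By the strictness in \<open>N_y\<close>, only x
  can have a full run compatible with a slope of absolute value at most
  \<open>N GenX\<close>.\<close>

locale central_power =
  fixes N :: "xy \<Rightarrow> nat"
    and E :: "xy letter list \<Rightarrow> xy letter list \<Rightarrow> bool"
  assumes N_x: "2 \<le> N GenX"
    and N_y: "N GenY = 0 \<or> N GenX < N GenY"
    and E_refl [simp]: "E u u"
    and E_sym: "E u v \<Longrightarrow> E v u"
    and E_trans [trans]: "E u v \<Longrightarrow> E v w \<Longrightarrow> E u w"
    and E_append: "E u u' \<Longrightarrow> E v v' \<Longrightarrow> E (u @ v) (u' @ v')"
    and E_cancel: "E [(g, s), (g, \<not> s)] []"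
    and E_central: "E (replicate (N GenX) (GenX, True) @ [(GenY, True)])
      ([(GenY, True)] @ replicate (N GenX) (GenX, True))"
    and E_power: "N GenY \<noteq> 0 \<Longrightarrow>
      E (replicate (N GenY) (GenY, True)) (replicate (N GenX) (GenX, True))"
    and E_steps: "E u v \<Longrightarrow> steps N ([], 0) u = steps N ([], 0) v"
begin

section \<open>Cancellation and central elements\<close>

lemma E_mid: "E u v \<Longrightarrow> E (a @ u @ b) (a @ v @ b)"
  by (intro E_append) simp_all

lemma E_left: "E u v \<Longrightarrow> E (a @ u) (a @ v)"
  by (intro E_append) simp_all

lemma E_right: "E u v \<Longrightarrow> E (u @ b) (v @ b)"
  by (intro E_append) simp_all

lemma E_inv: "E (u @ inv_word u) []"
proof (induction u)
  case (Cons l u)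
  obtain g s where l: "l = (g, s)" by (cases l)
  have "E ([l] @ (u @ inv_word u) @ [(g, \<not> s)]) ([l] @ [] @ [(g, \<not> s)])"
    by (rule E_mid[OF Cons.IH])
  also have "E ([l] @ [] @ [(g, \<not> s)]) []"
    using E_cancel by (simp add: l)
  finally show ?case by (simp add: l inv_word_def)
qed simp

lemma E_inv': "E (inv_word u @ u) []"
  using E_inv[of "inv_word u"] by simp

lemma E_left_cancel:
  assumes "E (a @ u) (a @ v)" shows "E u v"
proof -
  have "E ([] @ u) ((inv_word a @ a) @ u)" by (rule E_right[OF E_sym[OF E_inv']])
  also have "E ((inv_word a @ a) @ u) (inv_word a @ a @ v)"
    using E_left[OF assms, of "inv_word a"] by simp
  also have "E (inv_word a @ a @ v) ([] @ v)"
    using E_right[OF E_inv', of a v] by simp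
  finally show ?thesis by simp
qed

lemma E_right_cancel:
  assumes "E (u @ b) (v @ b)" shows "E u v"
proof -
  have "E (u @ []) (u @ b @ inv_word b)" by (rule E_left[OF E_sym[OF E_inv]])
  also have "E (u @ b @ inv_word b) ((v @ b) @ inv_word b)"
    using E_right[OF assms, of "inv_word b"] by simp
  also have "E ((v @ b) @ inv_word b) (v @ [])"
    using E_left[OF E_inv, of v b] by simp
  finally show ?thesis by simp
qed

lemma E_inv_word:
  assumes "E u v" shows "E (inv_word u) (inv_word v)"
proof (rule E_right_cancel)
  have "E (inv_word u @ v) (inv_word u @ u)" by (rule E_left[OF E_sym[OF assms]])
  also have "E (inv_word u @ u) []" by (rule E_inv')
  also have "E [] (inv_word v @ v)" by (rule E_sym[OF E_inv'])
  finally show "E (inv_word u @ v) (inv_word v @ v)" .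
qed

definition central :: "xy letter list \<Rightarrow> bool" where
  "central z \<longleftrightarrow> (\<forall>u. E (z @ u) (u @ z))"

lemma centralD: "central z \<Longrightarrow> E (z @ u) (u @ z)"
  by (simp add: central_def)

lemma central_Nil: "central []"
  by (simp add: central_def)

lemma central_append:
  assumes "central z" "central z'" shows "central (z @ z')"
  unfolding central_def
proof
  fix u
  have "E (z @ (z' @ u)) (z @ (u @ z'))" by (rule E_left[OF centralD[OF assms(2)]])
  also have "E (z @ (u @ z')) ((u @ z) @ z')"
    using E_right[OF centralD[OF assms(1)], of u z'] by simp
  finally show "E ((z @ z') @ u) (u @ z @ z')" by simp
qed

lemma commute_inv:
  assumes "E (z @ u) (u @ z)"
  shows "E (z @ inv_word u) (inv_word u @ z)"
proof (rule E_left_cancel)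
  have "E (u @ (z @ inv_word u)) ((z @ u) @ inv_word u)"
    using E_right[OF E_sym[OF assms], of "inv_word u"] by simp
  also have "E ((z @ u) @ inv_word u) (z @ [])"
    using E_left[OF E_inv, of z u] by simp
  also have "E (z @ []) ((u @ inv_word u) @ z)"
    using E_right[OF E_sym[OF E_inv], of z u] by simp
  finally show "E (u @ (z @ inv_word u)) (u @ (inv_word u @ z))" by simp
qed

lemma central_inv_word:
  assumes "central z" shows "central (inv_word z)"
  unfolding central_def
  using commute_inv[OF E_sym[OF centralD[OF assms]]] by (blast intro: E_sym)

text \<open>A word for \<Delta> or, if \<open>s\<close> is false, for its inverse.\<close>

definition block :: "bool \<Rightarrow> xy letter list" where
  "block s = replicate (N GenX) (GenX, s)"

lemma length_block [simp]: "length (block s) = N GenX"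
  by (simp add: block_def)

lemma inv_word_block: "inv_word (block s) = block (\<not> s)"
  by (simp add: block_def)

lemma central_block: "central (block s)"
proof -
  have pos: "E (block True @ [(g, True)]) ([(g, True)] @ block True)" for g
    using E_central by (cases g) (simp_all add: block_def replicate_append_same)
  have letter: "E (block True @ [l]) ([l] @ block True)" for l
  proof (cases l)
    case (Pair g t)
    then show ?thesis
      using pos[of g] commute_inv[OF pos[of g]] by (cases t) (simp_all add: inv_word_def)
  qed
  have "E (block True @ u) (u @ block True)" for u
  proof (induction u)
    case (Cons l u)
    have "E ((block True @ [l]) @ u) (([l] @ block True) @ u)" by (rule E_right[OF letter])
    also have "E (([l] @ block True) @ u) ([l] @ (u @ block True))"
      using E_left[OF Cons.IH, of "[l]"] by simp
    finally show ?case by simp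
  qed simp
  then have "central (block True)" by (simp add: central_def)
  from this central_inv_word[OF this] show ?thesis
    by (cases s) (simp_all add: inv_word_block)
qed

lemma E_block: "E (block s @ block (\<not> s)) []"
  using E_inv[of "block s"] by (simp add: inv_word_block)

text \<open>Full runs of both generators give the same central element, which lets exponents be
  traded between runs of different generators.\<close>

lemma E_full:
  assumes "N g \<noteq> 0" shows "E (replicate (N g) (g, s)) (block s)"
proof (cases g)
  case GenX
  then show ?thesis by (simp add: block_def)
next
  case GenY
  have True: "E (replicate (N g) (g, True)) (block True)"
    using assms E_power by (simp add: GenY block_def)
  then show ?thesis
    using E_inv_word[OF True] by (cases s) (simp_all add: inv_word_block)
qed

lemma central_power: "central (replicate (N GenX * k) (GenX, s))"
proof (induction k)
  case (Suc k)
  then show ?case using central_append[OF central_block Suc.IH]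
    by (simp add: block_def replicate_add)
qed (simp add: central_Nil)

section \<open>Distances in the Cayley graph and fellow traveling\<close>

definition near :: "nat \<Rightarrow> xy letter list \<Rightarrow> xy letter list \<Rightarrow> bool" where
  "near K u v \<longleftrightarrow> (\<exists>V. length V \<le> K \<and> E (u @ V) v)"

lemma near_mono: "near K u v \<Longrightarrow> K \<le> L \<Longrightarrow> near L u v"
  unfolding near_def by (meson le_trans)

lemma near_refl: "near K u u"
  by (auto simp: near_def intro: exI[of _ "[]"])

lemma near_trans:
  assumes "near K u v" "near L v w" shows "near (K + L) u w"
proof -
  obtain V W where V: "length V \<le> K" "E (u @ V) v" and W: "length W \<le> L" "E (v @ W) w"
    using assms by (auto simp: near_def)
  have "E ((u @ V) @ W) w" using E_right[OF V(2)] W(2) by (rule E_trans)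
  with V(1) W(1) show ?thesis
    unfolding near_def by (intro exI[of _ "V @ W"]) simp
qed

lemma near_sym:
  assumes "near K u v" shows "near K v u"
proof -
  obtain V where V: "length V \<le> K" "E (u @ V) v"
    using assms by (auto simp: near_def)
  have "E (v @ inv_word V) ((u @ V) @ inv_word V)" by (rule E_right[OF E_sym[OF V(2)]])
  also have "E ((u @ V) @ inv_word V) (u @ [])" using E_left[OF E_inv, of u V] by simp
  finally show ?thesis
    using V(1) unfolding near_def by (intro exI[of _ "inv_word V"]) simp
qed

lemma near_left: "near K u v \<Longrightarrow> near K (a @ u) (a @ v)"
  by (auto simp: near_def dest: E_left)

lemma near_append: "length V \<le> K \<Longrightarrow> near K u (u @ V)"
  by (auto simp: near_def)

lemma near_append': "length V \<le> K \<Longrightarrow> near K (u @ V) u"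
  by (intro near_sym[OF near_append])

lemma near_take:
  assumes "i \<le> j + K" "j \<le> i + K"
  shows "near K (take i u) (take j u)"
proof -
  have *: "near K (take i u) (take j u)" if "i \<le> j" "j \<le> i + K" for i j
  proof -
    have "take j u = take i u @ take (j - i) (drop i u)"
      using that(1) by (metis le_add_diff_inverse take_add)
    with that(2) show ?thesis by (simp add: near_append)
  qed
  show ?thesis
    using *[of i j] near_sym[OF *[of j i]] assms by (cases "i \<le> j") simp_all
qed

text \<open>Fellow traveling of words whose endpoints differ by a central \<open>z\<close>. Inside a
  longer word, such a replacement moves the later prefixes by \<open>z\<close> only; the length
  bounds control the offset of their indices.\<close>

definition shift :: "nat \<Rightarrow> xy letter list \<Rightarrow> xy letter list \<Rightarrow> xy letter list \<Rightarrow> bool" where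
  "shift K z w w' \<longleftrightarrow> central z \<and> E w' (w @ z) \<and> (\<forall>i. near K (take i w) (take i w'))
     \<and> length w \<le> length w' + K \<and> length w' \<le> length w + K"

lemma shift_refl: "shift 0 [] w w"
  by (simp add: shift_def central_Nil near_refl)

lemma shift_mono: "shift K z w w' \<Longrightarrow> K \<le> L \<Longrightarrow> shift L z w w'"
  by (auto simp: shift_def intro: near_mono)

lemma shift_base:
  assumes "central z" "E w' (w @ z)" shows "shift (length w + length w') z w w'"
proof -
  have "near (length w + length w') (take i w) (take i w')" for i
  proof -
    have "near (length w + length w') (take i w @ []) ([] @ take i w')"
      using near_trans[OF near_append'[of "take i w" _ "[]"] near_append[of "take i w'" _ "[]"]]
      by simp
    then show ?thesis by simp
  qed
  with assms show ?thesis by (simp add: shift_def)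
qed

lemma shift_trans:
  assumes "shift K z w w'" "shift L z' w' w''"
  shows "shift (K + L) (z @ z') w w''"
proof -
  have "E w'' (w' @ z')" using assms(2) by (simp add: shift_def)
  also have "E (w' @ z') ((w @ z) @ z')" using assms(1) by (intro E_right) (simp add: shift_def)
  finally show ?thesis
    using assms by (auto simp: shift_def intro: central_append near_trans)
qed

text \<open>Past both first factors, prefixes are compared in three moves: \<open>v\<close> with
  \<open>v'\<close> (L), the index offset (K), and \<open>z\<close> (K). Otherwise at most
  \<open>K\<close> letters of \<open>v\<close> and of \<open>v'\<close> are involved, which gives 3
  * K.\<close>

lemma shift_append:
  assumes "shift K z w w'" "shift L y v v'"
  shows "shift (3 * K + L) (z @ y) (w @ v) (w' @ v')"
proof -
  have z: "central z" "E w' (w @ z)" and y: "central y" "E v' (v @ y)"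
    and nw: "near K (take i w) (take i w')" and nv: "near L (take i v) (take i v')"
    and lw: "length w \<le> length w' + K" "length w' \<le> length w + K"
    and lv: "length v \<le> length v' + L" "length v' \<le> length v + L" for i
    using assms by (simp_all add: shift_def)
  have "E (w' @ v') ((w @ z) @ (v @ y))" using z y by (intro E_append)
  also have "E ((w @ z) @ (v @ y)) (w @ (v @ z) @ y)"
    using E_mid[OF centralD[OF z(1)], of w v y] by simp
  finally have E: "E (w' @ v') ((w @ v) @ z @ y)" by simp
  have n: "near (3 * K + L) (take i (w @ v)) (take i (w' @ v'))" for i
  proof (cases "length w \<le> i \<and> length w' \<le> i")
    case True
    let ?a = "i - length w" and ?a' = "i - length w'"
    obtain V where V: "length V \<le> K" "E (w @ V) w'"
      using nw[of i] True by (auto simp: near_def)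
    \<comment> \<open>The word witnessing nearness at the ends of \<open>w\<close> and
      \<open>w'\<close> represents \<open>z\<close>, so \<open>z\<close> has length at most
      \<open>K\<close>.\<close>
    have Vz: "E V z" using E_left_cancel[OF E_trans[OF V(2) z(2)]] .
    have "near L (w @ take ?a v) (w @ take ?a v')" by (rule near_left[OF nv])
    moreover have "near K (w @ take ?a v') (w @ take ?a' v')"
      using lw True by (intro near_left near_take) linarith+
    moreover have "near K (w @ take ?a' v') (w' @ take ?a' v')"
    proof -
      have "E ((w @ take ?a' v') @ V) (w @ (take ?a' v' @ z))"
        using E_left[OF Vz, of "w @ take ?a' v'"] by simp
      also have "E (w @ (take ?a' v' @ z)) (w @ (z @ take ?a' v'))"
        by (rule E_left[OF E_sym[OF centralD[OF z(1)]]])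
      also have "E (w @ (z @ take ?a' v')) (w' @ take ?a' v')"
        using E_right[OF E_sym[OF z(2)], of "take ?a' v'"] by simp
      finally show ?thesis using V(1) by (auto simp: near_def)
    qed
    ultimately have "near ((L + K) + K) (w @ take ?a v) (w' @ take ?a' v')"
      by (intro near_trans)
    then show ?thesis
      using True by (auto intro: near_mono)
  next
    case False
    let ?a = "i - length w" and ?a' = "i - length w'"
    have "?a \<le> K" "?a' \<le> K" using lw False by linarith+
    then have "near ((K + K) + K) (take i w @ take ?a v) (take i w' @ take ?a' v')"
      by (intro near_trans[OF near_trans[OF near_append' nw] near_append]) simp_all
    then show ?thesis by (auto intro: near_mono)
  qed
  from E n lw lv z(1) y(1) show ?thesis
    by (simp add: shift_def central_append)
qed

lemma shift_context:
  assumes "shift K z w w'"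
  shows "shift (3 * K) z (u @ w @ v) (u @ w' @ v)"
  using shift_append[OF shift_refl[of u] shift_append[OF assms shift_refl[of v]]] by simp

text \<open>\<open>deletion e z z0 k\<close>: removing \<open>k\<close> blocks \<open>x\<^sup>\<plusminus>\<^sup>p\<close> of sign \<open>e\<close> from \<open>z\<close> leaves \<open>z0\<close>.\<close>

inductive deletion :: "bool \<Rightarrow> xy letter list \<Rightarrow> xy letter list \<Rightarrow> nat \<Rightarrow> bool" for e where
  Nil: "deletion e [] [] 0"
| letter: "deletion e z z0 k \<Longrightarrow> deletion e (z @ [l]) (z0 @ [l]) k"
| block: "deletion e z z0 k \<Longrightarrow> deletion e (z @ block e) z0 (Suc k)"

lemma deletion_refl: "deletion e z z 0"
  by (induction z rule: rev_induct) (auto intro: deletion.intros)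

lemma deletion_append:
  "deletion e v v0 j \<Longrightarrow> deletion e u u0 k \<Longrightarrow> deletion e (u @ v) (u0 @ v0) (k + j)"
proof (induction rule: deletion.induct)
  case (letter z z0 k' l)
  then show ?case using deletion.letter[of e "u @ z" "u0 @ z0"] by simp
next
  case (block z z0 k')
  then show ?case using deletion.block[of e "u @ z" "u0 @ z0"] by simp
qed simp

lemma deletion_powers: "deletion e (replicate (N GenX * k) (GenX, e)) [] k"
proof (induction k)
  case (Suc k)
  have "replicate (N GenX * Suc k) (GenX, e) = replicate (N GenX * k) (GenX, e) @ block e"
    by (simp add: block_def replicate_add[symmetric] add.commute)
  then show ?case using deletion.block[OF Suc.IH] by (simp del: mult_Suc_right)
qed (simp add: deletion.Nil)

lemma deletion_length: "deletion e z z0 k \<Longrightarrow> length z = length z0 + N GenX * k"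
  by (induction rule: deletion.induct) simp_all

lemma deletion_set: "deletion e z z0 k \<Longrightarrow> set z \<subseteq> set z0 \<union> {(GenX, e)}"
  by (induction rule: deletion.induct) (auto simp: block_def)

lemma deletion_E: "deletion e z z0 k \<Longrightarrow> E z (z0 @ replicate (N GenX * k) (GenX, e))"
proof (induction rule: deletion.induct)
  case (letter z z0 k l)
  let ?r = "replicate (N GenX * k) (GenX, e)"
  have "E (z @ [l]) ((z0 @ ?r) @ [l])" by (rule E_right[OF letter.IH])
  also have "E ((z0 @ ?r) @ [l]) (z0 @ ([l] @ ?r))"
    using E_left[OF centralD[OF central_power], of z0 k e "[l]"] by simp
  finally show ?case by simp
next
  case (block z z0 k)
  have "E (z @ block e) ((z0 @ replicate (N GenX * k) (GenX, e)) @ block e)"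
    by (rule E_right[OF block.IH])
  moreover have "replicate (N GenX * Suc k) (GenX, e) = replicate (N GenX * k) (GenX, e) @ block e"
    by (simp add: block_def replicate_add[symmetric] add.commute)
  ultimately show ?case by (simp del: mult_Suc_right)
qed simp

text \<open>Lets a run of \<open>w0\<close> be found in \<open>w\<close> as a factor interspersed
  with deleted blocks.\<close>

lemma deletion_split:
  "deletion e w w0 k \<Longrightarrow> w0 = a @ b \<Longrightarrow>
    \<exists>u v i j. w = u @ v \<and> deletion e u a i \<and> deletion e v b j \<and> k = i + j"
proof (induction arbitrary: b rule: deletion.induct)
  case Nil
  then show ?case by (auto intro: deletion.Nil)
next
  case (letter z z0 k l)
  show ?case
  proof (cases b rule: rev_cases)
    case Nil
    with letter show ?thesis
      by (metis append.right_neutral add.right_neutral deletion.letter deletion.Nil)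
  next
    case (snoc b' l')
    with letter.prems have "z0 = a @ b'" "l' = l" by simp_all
    with letter.IH[OF this(1)] snoc show ?thesis
      by (metis append.assoc deletion.letter)
  qed
next
  case (block z z0 k)
  from block.IH[OF block.prems] show ?case
    by (metis append.assoc add_Suc_right deletion.block)
qed

lemma deletion_block: "deletion e w w0 k \<Longrightarrow> 0 < k \<Longrightarrow> sublist (block e) w"
  by (induction rule: deletion.induct) (auto simp: sublist_append)

text \<open>Complete blocks are central and move right past the letters of \<open>z0\<close>; an
  incomplete one can occur only at the cut, where it already stands last.\<close>

lemma deletion_take:
  "deletion e z z0 k \<Longrightarrow>
    \<exists>a n. a \<le> length z0 \<and> a + n = min i (length z) \<and>
      E (take i z) (take a z0 @ replicate n (GenX, e))"
proof (induction rule: deletion.induct)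
  case Nil
  show ?case by simp
next
  case (letter z z0 k l)
  show ?case
  proof (cases "i \<le> length z")
    case True
    from letter.IH obtain a n where "a \<le> length z0" "a + n = min i (length z)"
      "E (take i z) (take a z0 @ replicate n (GenX, e))" by blast
    with True show ?thesis
      by (intro exI[of _ a] exI[of _ n]) simp
  next
    case False
    have "E (z @ [l]) ((z0 @ [l]) @ replicate (N GenX * k) (GenX, e))"
      by (rule deletion_E[OF deletion.letter[OF letter.hyps]])
    with False deletion_length[OF letter.hyps] show ?thesis
      by (intro exI[of _ "Suc (length z0)"] exI[of _ "N GenX * k"]) simp
  qed
next
  case (block z z0 k)
  show ?case
  proof (cases "i \<le> length z")
    case True
    with block.IH show ?thesis by auto
  next
    case False
    let ?n = "min (i - length z) (N GenX)"
    have "E (z @ replicate ?n (GenX, e)) ((z0 @ replicate (N GenX * k) (GenX, e)) @ replicate ?n (GenX, e))"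
      by (rule E_right[OF deletion_E[OF block.hyps]])
    with False deletion_length[OF block.hyps] show ?thesis
      by (intro exI[of _ "length z0"] exI[of _ "N GenX * k + ?n"])
        (auto simp: block_def replicate_add min.commute)
  qed
qed

text \<open>The bound depends on \<open>z0\<close> only: however many blocks are deleted, \<open>z\<close> follows the powers of
  \<open>x\<close> closely, so that two such words with equal endpoints fellow travel.\<close>

lemma deletion_axis:
  assumes "deletion e z z0 k"
  shows "near (2 * N GenX + 2 * length z0) (take i z) (replicate (min i (length z)) (GenX, e))"
proof -
  obtain a n where a: "a \<le> length z0" "a + n = min i (length z)"
    and E: "E (take i z) (take a z0 @ replicate n (GenX, e))"
    using deletion_take[OF assms] by blast
  \<comment> \<open>Only multiples of \<open>N GenX\<close> give central powers, so the
    \<open>r\<close> surplus letters are cancelled before \<open>take a z0\<close> is moved behind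
    the power.\<close>
  define j r where "j = n div N GenX" and "r = n mod N GenX"
  have n: "n = N GenX * j + r" and r: "r \<le> N GenX"
    using N_x by (auto simp: j_def r_def intro: less_imp_le)
  let ?x = "\<lambda>n. replicate n (GenX, e)"
  let ?t = "take a z0"
  have "E (take i z @ inv_word (?x r)) ((?t @ ?x (N GenX * j) @ ?x r) @ inv_word (?x r))"
    using E by (intro E_right) (simp add: n replicate_add)
  also have "E ((?t @ ?x (N GenX * j) @ ?x r) @ inv_word (?x r)) (?t @ ?x (N GenX * j))"
    using E_left[OF E_inv, of "?t @ ?x (N GenX * j)" "?x r"] by simp
  also have "E (?t @ ?x (N GenX * j)) (?x (N GenX * j) @ ?t)"
    by (rule E_sym[OF centralD[OF central_power]])
  finally have "near r (take i z) (?x (N GenX * j) @ ?t)"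
    unfolding near_def by (intro exI[of _ "inv_word (?x r)"]) simp
  moreover have "near a (?x (N GenX * j) @ ?t) (?x (N GenX * j))"
    by (rule near_append') simp
  moreover have "near (r + a) (?x (N GenX * j)) (?x (N GenX * j) @ ?x (r + a))"
    by (rule near_append) simp
  ultimately have "near (r + a + (r + a)) (take i z) (?x (N GenX * j) @ ?x (r + a))"
    by (rule near_trans[OF near_trans])
  moreover have "?x (N GenX * j) @ ?x (r + a) = ?x (min i (length z))"
    using a(2) n by (simp add: replicate_add[symmetric] algebra_simps)
  ultimately show ?thesis
    using a(1) r by (auto intro: near_mono)
qed

text \<open>Both words stay near the powers of x of sign \<open>e\<close>, and the length bounds
  keep their positions there within \<open>L\<close> of each other.\<close>

lemma shift_deletion:
  assumes z: "deletion e z z0 k" and z': "deletion e z' z0' k'"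
    and E: "E z' (z @ y)" and y: "central y"
    and len: "length z \<le> length z' + L" "length z' \<le> length z + L"
  shows "shift (4 * N GenX + 2 * length z0 + 2 * length z0' + L) y z z'"
proof -
  let ?K = "4 * N GenX + 2 * length z0 + 2 * length z0' + L"
  let ?x = "\<lambda>n. replicate n (GenX, e)"
  have "near ?K (take i z) (take i z')" for i
  proof -
    have "near L (?x (min i (length z))) (?x (min i (length z')))"
      using near_take[of "min i (length z)" "min i (length z')" L "?x (i + length z + length z')"] len
      by simp
    from near_trans[OF near_trans[OF deletion_axis[OF z] this] near_sym[OF deletion_axis[OF z']]]
    show ?thesis by (auto intro: near_mono)
  qed
  with assms show ?thesis by (simp add: shift_def)
qed

section \<open>Deleting central blocks and shortening words\<close>

definition width :: nat where
  "width = N GenX + N GenY"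

lemma N_le_width: "N g \<le> width"
  by (cases g) (simp_all add: width_def)

lemma deletion_0: "deletion e w w0 k \<Longrightarrow> k = 0 \<Longrightarrow> w = w0"
  by (induction rule: deletion.induct) simp_all

text \<open>A flip costs 7 * \<open>width\<close> on the replaced factor, hence 21 *
  \<open>width\<close> in context; a shortening takes up to two flips.\<close>

definition shortenable :: "xy letter list \<Rightarrow> bool" where
  "shortenable w \<longleftrightarrow> (\<exists>z w'. shift (42 * width) z w w' \<and> E z [] \<and> length w' < length w)"

lemma shortenableI:
  "shift (42 * width) z w w' \<Longrightarrow> E z [] \<Longrightarrow> length w' < length w \<Longrightarrow> shortenable w"
  by (auto simp: shortenable_def)

text \<open>With n = \<open>N g\<close>, trading g^b for g^(b-n), or inversely, multiplies by a
  central element and changes the length by n - 2b. Deleted blocks inside the run are collected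
  behind it; the \<open>sublist\<close> conclusions record what survives for a second move.\<close>

lemma flip:
  assumes del: "deletion e w w0 k" and sub: "sublist (replicate b (g, s)) w0"
    and N: "N g \<noteq> 0" "b \<le> N g"
  shows "\<exists>u z v w'. w = u @ z @ v \<and> (k = 0 \<longrightarrow> z = replicate b (g, s)) \<and>
    sublist u w' \<and> sublist v w' \<and> (k > 0 \<longrightarrow> sublist (block e) w') \<and>
    shift (21 * width) (block (\<not> s)) w w' \<and> length w' + 2 * b = length w + N g"
proof -
  obtain a c where w0: "w0 = a @ replicate b (g, s) @ c"
    using sub by (auto simp: sublist_def)
  from deletion_split[OF del w0] obtain u y i m where y: "w = u @ y" "deletion e u a i"
    "deletion e y (replicate b (g, s) @ c) m" "k = i + m"
    by blast
  from deletion_split[OF y(3) HOL.refl] obtain z v j l where z: "y = z @ v"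
    "deletion e z (replicate b (g, s)) j" "deletion e v c l" "m = j + l"
    by blast
  let ?x = "replicate (N GenX * j) (GenX, e)"
  define z' where "z' = replicate (N g - b) (g, \<not> s) @ ?x"
  define w' where "w' = u @ z' @ v"
  have dz': "deletion e z' (replicate (N g - b) (g, \<not> s)) j"
    using deletion_append[OF deletion_powers deletion_refl] by (simp add: z'_def)
  have lz: "length z = b + N GenX * j" using deletion_length[OF z(2)] by simp
  have lz': "length z' = N g - b + N GenX * j" by (simp add: z'_def)
  have "E (z @ block (\<not> s)) ((replicate b (g, s) @ ?x) @ block (\<not> s))"
    by (rule E_right[OF deletion_E[OF z(2)]])
  also have "E ((replicate b (g, s) @ ?x) @ block (\<not> s)) (replicate b (g, s) @ (block (\<not> s) @ ?x))"
    using E_left[OF E_sym[OF centralD[OF central_block]], of "replicate b (g, s)" ?x "\<not> s"] by simp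
  also have "E (replicate b (g, s) @ (block (\<not> s) @ ?x))
      (replicate b (g, s) @ (replicate (N g) (g, \<not> s) @ ?x))"
    by (intro E_left E_right E_sym[OF E_full] N)
  also have "replicate b (g, s) @ (replicate (N g) (g, \<not> s) @ ?x)
      = (replicate b (g, s) @ inv_word (replicate b (g, s))) @ z'"
    using N(2) by (simp add: z'_def replicate_add[symmetric])
  also have "E ((replicate b (g, s) @ inv_word (replicate b (g, s))) @ z') z'"
    using E_right[OF E_inv, of "replicate b (g, s)" z'] by simp
  finally have "E z' (z @ block (\<not> s))" by (rule E_sym)
  from shift_deletion[OF z(2) dz' this central_block, of "N g"] lz lz' N(2)
  have "shift (4 * N GenX + 2 * b + 2 * (N g - b) + N g) (block (\<not> s)) z z'"
    by simp
  then have "shift (7 * width) (block (\<not> s)) z z'"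
    by (rule shift_mono) (use N_le_width[of g] N_le_width[of GenX] N(2) in linarith)
  from shift_context[OF this, of u v] have sh: "shift (21 * width) (block (\<not> s)) w w'"
    by (simp add: w'_def y(1) z(1))
  have "z = replicate b (g, s)" if "k = 0"
    using that y(4) z(4) deletion_0[OF z(2)] by simp
  moreover have "sublist (block e) w'" if "0 < k"
  proof -
    from that y(4) z(4) have "0 < i \<or> 0 < j \<or> 0 < l" by linarith
    then show ?thesis
      using deletion_block[OF y(2)] deletion_block[OF dz'] deletion_block[OF z(3)]
      by (auto simp: w'_def sublist_append)
  qed
  moreover have "w = u @ z @ v" "sublist u w'" "sublist v w'" "length w' + 2 * b = length w + N g"
    using lz lz' N(2) by (simp_all add: y(1) z(1) w'_def sublist_append)
  ultimately show ?thesis using sh by blast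
qed

text \<open>Inserting \<open>block s\<close> undoes the central change of the flip and costs fewer
  letters than the flip saves.\<close>

lemma flip_insert:
  assumes "deletion e w w0 k" "sublist (replicate b (g, s)) w0" "N g \<noteq> 0" "b \<le> N g"
    and long: "N g + N GenX < 2 * b"
  shows "shortenable w"
proof -
  obtain w' where sh: "shift (21 * width) (block (\<not> s)) w w'"
    and len: "length w' + 2 * b = length w + N g"
    using flip[OF assms(1-4)] by blast
  have "shift (3 * N GenX) (block s) w' (block s @ w')"
    using shift_context[OF shift_base[OF central_block, of "block s" "[]" s], of "[]" w'] by simp
  from shift_trans[OF sh this] have "shift (42 * width) (block (\<not> s) @ block s) w (block s @ w')"
    by (rule shift_mono) (use N_le_width[of GenX] in simp)
  then show ?thesis
    by (rule shortenableI) (use len long E_block[of "\<not> s"] in simp_all)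
qed

text \<open>The flip multiplies by \<open>block e\<close>, which is undone by removing a copy of
  \<open>block e\<close> from the word; this saves another \<open>N GenX\<close> letters.\<close>

lemma flip_remove:
  assumes "deletion e w w0 k" "0 < k" "sublist (replicate b (g, \<not> e)) w0" "N g \<noteq> 0" "b \<le> N g"
    and long: "N g < 2 * b + N GenX"
  shows "shortenable w"
proof -
  obtain w' where sh: "shift (21 * width) (block e) w w'" and sub: "sublist (block e) w'"
    and len: "length w' + 2 * b = length w + N g"
    using flip[OF assms(1,3-5)] assms(2) by auto
  obtain u v where w': "w' = u @ block e @ v"
    using sub by (auto simp: sublist_def)
  have "shift (3 * N GenX) (block (\<not> e)) w' (u @ [] @ v)"
    unfolding w' using shift_context[OF shift_base[OF central_block E_sym[OF E_block]]] by simp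
  from shift_trans[OF sh this] have "shift (42 * width) (block e @ block (\<not> e)) w (u @ [] @ v)"
    by (rule shift_mono) (use N_le_width[of GenX] in simp)
  then show ?thesis
    by (rule shortenableI) (use len long w' in \<open>simp_all add: E_block\<close>)
qed

text \<open>The central changes of flips of opposite sign cancel, while their length changes add
  up.\<close>

lemma flip_flip:
  assumes b: "sublist (replicate b (g, True)) w" "N g \<noteq> 0" "b \<le> N g"
    and c: "sublist (replicate c (h, False)) w" "N h \<noteq> 0" "c \<le> N h" "0 < c"
    and long: "N g + N h < 2 * b + 2 * c"
  shows "shortenable w"
proof -
  obtain u v w' where w: "w = u @ replicate c (h, False) @ v" and "sublist u w'" "sublist v w'"
    and sh: "shift (21 * width) (block True) w w'" and len: "length w' + 2 * c = length w + N h"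
    using flip[OF deletion_refl c(1-3)] by auto
  moreover have "sublist (replicate b (g, True)) u \<or> sublist (replicate b (g, True)) v"
    using b(1) c(4) unfolding w by (rule_tac sublist_replicate_split) auto
  ultimately have "sublist (replicate b (g, True)) w'"
    using sublist_order.order.trans by blast
  from flip[OF deletion_refl this b(2,3)]
  obtain w'' where sh': "shift (21 * width) (block False) w' w''"
    and len': "length w'' + 2 * b = length w' + N g"
    by auto
  have "shift (42 * width) (block True @ block False) w w''"
    using shift_trans[OF sh sh'] by simp
  then show ?thesis
    by (rule shortenableI) (use len len' long E_block[of True] in simp_all)
qed

text \<open>In \<open>w\<close> the two letters may be separated by deleted blocks; keeping just
  these blocks is a bounded change, as both words follow the powers of x.\<close>

lemma cancel_shortens:
  assumes del: "deletion e w w0 k" and sub: "sublist [(g, s), (g, \<not> s)] w0"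
  shows "shortenable w"
proof -
  let ?c = "[(g, s), (g, \<not> s)]"
  obtain a c where w0: "w0 = a @ ?c @ c"
    using sub by (auto simp: sublist_def)
  from deletion_split[OF del w0] obtain u y i m where y: "w = u @ y" "deletion e y (?c @ c) m"
    by blast
  from deletion_split[OF y(2) HOL.refl] obtain z v j l where z: "y = z @ v" "deletion e z ?c j"
    by blast
  let ?x = "replicate (N GenX * j) (GenX, e)"
  have "E ?x (z @ [])"
    using E_trans[OF deletion_E[OF z(2)] E_right[OF E_cancel]] by (simp add: E_sym)
  then have "shift (4 * N GenX + 6) [] z ?x"
    by (rule shift_mono[OF shift_deletion[OF z(2) deletion_powers _ central_Nil, where L = 2]])
      (use deletion_length[OF z(2)] in simp_all)
  from shift_context[OF this, of u v] have sh: "shift (42 * width) [] w (u @ ?x @ v)"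
    unfolding y z by (rule_tac shift_mono) (use N_x N_le_width[of GenX] in auto)
  have "length (u @ ?x @ v) < length w"
    using deletion_length[OF z(2)] by (simp add: y z)
  with sh show ?thesis by (rule shortenableI[OF _ E_refl])
qed

text \<open>The sign is that of some block in \<open>w\<close>, and \<open>k\<close> is maximal. For
  positive \<open>k\<close>, blocks of the opposite sign may remain; \<open>flip_remove\<close>
  handles them.\<close>

lemma maximal_deletion:
  obtains e k w0 where "deletion e w w0 k" "\<not> sublist (block e) w0"
    "k = 0 \<Longrightarrow> \<forall>s. \<not> sublist (block s) w0"
proof (cases "\<exists>e. sublist (block e) w")
  case True
  then obtain e a b where w: "w = a @ block e @ b" by (auto simp: sublist_def)
  have blk: "deletion e (block e) [] 1"
    using deletion.block[OF deletion.Nil] by simp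
  define P where "P k \<longleftrightarrow> (\<exists>w0. deletion e w w0 k)" for k
  have P1: "P 1"
    using deletion_append[OF deletion_append[OF deletion_refl blk] deletion_refl, of a b]
    by (auto simp: P_def w)
  have bd: "k \<le> length w" if Pk: "P k" for k
  proof -
    have "1 * k \<le> N GenX * k" using N_x by (intro mult_le_mono1) simp
    moreover obtain w0 where "deletion e w w0 k" using Pk by (auto simp: P_def)
    ultimately show ?thesis using deletion_length[of e w w0 k] by linarith
  qed
  obtain k where k: "P k" "\<And>j. P j \<Longrightarrow> j \<le> k"
    using P1 bd GreatestI_ex_nat[of P] Greatest_le_nat[of P] by metis
  then obtain w0 where w0: "deletion e w w0 k" by (auto simp: P_def)
  have "\<not> sublist (block e) w0"
  proof
    assume "sublist (block e) w0"
    then obtain c d where eq: "w0 = c @ block e @ d" by (auto simp: sublist_def)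
    from deletion_split[OF w0 eq] obtain u y i m where y: "w = u @ y" "deletion e u c i"
      "deletion e y (block e @ d) m" "k = i + m"
      by blast
    from deletion_split[OF y(3) HOL.refl] obtain z v j l where z: "y = z @ v"
      "deletion e z (block e) j" "deletion e v d l" "m = j + l"
      by blast
    \<comment> \<open>The block and the blocks interspersed in it consist of one letter, so
      \<open>z\<close> is a pure power and counts as one more block: deletions need no
      nesting.\<close>
    have "z = replicate (N GenX * Suc j) (GenX, e)"
      using deletion_set[OF z(2)] deletion_length[OF z(2)]
      by (intro replicate_eqI) (auto simp: block_def)
    then have "deletion e z [] (Suc j)" by (simp only: deletion_powers)
    from deletion_append[OF deletion_append[OF z(3) this] y(2)]
    have "P (Suc k)" by (auto simp: P_def y z)
    with k(2) show False by fastforce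
  qed
  with k(2)[OF P1] show ?thesis by (intro that[OF w0]) simp_all
next
  case False
  then show ?thesis using that[OF deletion_refl] by blast
qed

text \<open>If no move applies, some slope satisfies all run conditions and the height of
  \<open>w\<close> equals its length; then a shorter \<open>v\<close> violates the Lipschitz
  bound.\<close>

lemma nongeodesic_shortenable:
  assumes "E v w" "length v < length w"
  shows "shortenable w"
proof (rule ccontr)
  assume ns: "\<not> shortenable w"
  obtain e k w0 where del: "deletion e w w0 k" and max: "\<not> sublist (block e) w0"
    and k0: "k = 0 \<Longrightarrow> \<not> sublist (block (\<not> e)) w0"
    by (rule maximal_deletion) blast
  define p where "p = int (N GenX)"
  have Np: "N g = 0 \<or> p \<le> int (N g)" for g
    using N_y by (cases g) (auto simp: p_def)
  \<comment> \<open>With deleted blocks the slope is \<open>sg e * p\<close>, at which a block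
    raises the height by its own length.\<close>
  have "\<exists>\<kappa>. \<bar>\<kappa>\<bar> \<le> p \<and> (k = 0 \<or> \<kappa> = sg e * p) \<and>
    (\<forall>g s b. N g \<noteq> 0 \<longrightarrow> b \<le> N g \<longrightarrow> sublist (replicate b (g, s)) w0
      \<longrightarrow> 2 * int b \<le> int (N g) + sg s * \<kappa>)"
  proof (cases "k = 0")
    case False
    have "2 * int b \<le> int (N g) + sg s * (sg e * p)"
      if "N g \<noteq> 0" "b \<le> N g" "sublist (replicate b (g, s)) w0" for g s b
    proof (rule ccontr)
      assume *: "\<not> 2 * int b \<le> int (N g) + sg s * (sg e * p)"
      show False
      proof (cases "s = e")
        case True
        then have "N g + N GenX < 2 * b" using * by (cases e) (simp_all add: sg_def p_def)
        with flip_insert[OF del that(3,1,2)] ns show False by blast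
      next
        case ne: False
        then have "N g < 2 * b + N GenX" using * by (cases e; cases s) (simp_all add: sg_def p_def)
        moreover have "sublist (replicate b (g, \<not> e)) w0" using that(3) ne by (cases e; cases s) simp_all
        ultimately show False using flip_remove[OF del _ _ that(1,2)] False ns by blast
      qed
    qed
    then show ?thesis by (intro exI[of _ "sg e * p"]) (auto simp: sg_def p_def)
  next
    case True
    have w: "w0 = w" using deletion_0[OF del True] by simp
    define S where "S = {2 * int b - int (N g) | g b. N g \<noteq> 0 \<and> b \<le> N g \<and> sublist (replicate b (g, True)) w}"
    have "S \<subseteq> {- int width..int width}"
    proof
      fix t assume "t \<in> S"
      then obtain g b where "t = 2 * int b - int (N g)" "b \<le> N g" by (auto simp: S_def)
      with N_le_width[of g] show "t \<in> {- int width..int width}" by simp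
    qed
    then have fin: "finite S" by (rule finite_subset) simp
    \<comment> \<open>The empty run of x contributes 2 * 0 - p; this gives the lower bound on
      \<kappa>.\<close>
    have mem: "- p \<in> S"
      unfolding S_def p_def using N_x
      by (intro CollectI exI[of _ GenX] exI[of _ "0::nat"]) simp
    \<comment> \<open>the least slope that allows all positive runs; a negative run violating it conflicts with a positive
      run attaining the maximum\<close>
    define \<kappa> where "\<kappa> = Max S"
    have "\<kappa> \<in> S" unfolding \<kappa>_def using fin mem by (intro Max_in) auto
    then obtain g b where g: "\<kappa> = 2 * int b - int (N g)" "N g \<noteq> 0" "b \<le> N g"
      "sublist (replicate b (g, True)) w" by (auto simp: S_def)
    have lo: "- p \<le> \<kappa>" unfolding \<kappa>_def using fin mem by (rule Max_ge)
    have hi: "\<kappa> \<le> p"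
    proof (rule ccontr)
      assume "\<not> \<kappa> \<le> p"
      then have "N g + N GenX < 2 * b" using g(1) by (simp add: p_def)
      with flip_insert[OF deletion_refl g(4,2,3)] ns show False by blast
    qed
    have "2 * int c \<le> int (N h) + sg s * \<kappa>"
      if h: "N h \<noteq> 0" "c \<le> N h" "sublist (replicate c (h, s)) w" for h s c
    proof (cases s)
      case True
      have "2 * int c - int (N h) \<in> S"
        unfolding S_def using h True by (intro CollectI exI[of _ h] exI[of _ c]) simp
      with fin have "2 * int c - int (N h) \<le> \<kappa>" unfolding \<kappa>_def by (rule Max_ge)
      with True show ?thesis by (simp add: sg_def)
    next
      case False
      show ?thesis
      proof (rule ccontr)
        assume "\<not> ?thesis"
        then have *: "int (N h) - \<kappa> < 2 * int c" using False by (simp add: sg_def)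
        with hi Np[of h] h(1) have "0 < c" by auto
        moreover have "N g + N h < 2 * b + 2 * c" using * g(1) by simp
        ultimately show False
          using flip_flip[OF g(4,2,3) _ h(1,2)] h(3) False ns by simp
      qed
    qed
    with lo hi True w show ?thesis by (intro exI[of _ \<kappa>]) auto
  qed
  then obtain \<kappa> where \<kappa>: "\<bar>\<kappa>\<bar> \<le> p" "k = 0 \<or> \<kappa> = sg e * p"
    and short: "\<And>g s b. N g \<noteq> 0 \<Longrightarrow> b \<le> N g \<Longrightarrow> sublist (replicate b (g, s)) w0
      \<Longrightarrow> 2 * int b \<le> int (N g) + sg s * \<kappa>"
    by blast
  have slope: "N g = 0 \<or> \<bar>\<kappa>\<bar> \<le> int (N g)" for g
    using Np[of g] \<kappa>(1) by auto
  \<comment> \<open>A full run would force \<open>N g\<close> to be at most \<open>p\<close>, so it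
    would be a block, excluded by the deletion or by the slope.\<close>
  have lt: "b < N g" if "N g \<noteq> 0" "sublist (replicate b (g, s)) w0" for g s b
  proof (rule ccontr)
    assume "\<not> b < N g"
    then have "replicate b (g, s) = replicate (N g) (g, s) @ replicate (b - N g) (g, s)"
      by (simp add: replicate_add[symmetric])
    then have sub: "sublist (replicate (N g) (g, s)) w0"
      using that(2) sublist_order.order.trans by (metis sublist_append_rightI)
    from short[OF that(1) _ this] have le: "int (N g) \<le> sg s * \<kappa>" by simp
    also have "\<dots> \<le> p" using \<kappa>(1) by (auto simp: sg_def)
    finally have "g = GenX"
      using N_y that(1) by (cases g) (auto simp: p_def)
    with sub have blk: "sublist (block s) w0" by (simp add: block_def)
    show False
    proof (cases "s = e")
      case True
      with blk max show False by simp
    next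
      case False
      then have "s = (\<not> e)" by auto
      with blk k0 \<kappa>(2) have "\<kappa> = sg e * p" by blast
      with le \<open>s = (\<not> e)\<close> \<open>g = GenX\<close> N_x show False by (cases e) (simp_all add: sg_def p_def)
    qed
  qed
  have red: "\<not> sublist [(g, s), (g, \<not> s)] w0" for g s
    using cancel_shortens[OF del] ns by blast
  have tight: "height N \<kappa> (steps N ([], 0) w0) = int (length w0)"
  proof (rule height_tight[OF slope red])
    show "b < N g \<and> 2 * int b \<le> int (N g) + sg s * \<kappa>"
      if "N g \<noteq> 0" "sublist (replicate b (g, s)) w0" for g s b
      using short[OF that(1) less_imp_le[OF lt[OF that]] that(2)] lt[OF that] by simp
  qed
  have val: "valid N (fst (steps N ([], 0) w0))"
    by (rule valid_steps) simp
  \<comment> \<open>Restoring the blocks adds \<open>sg e * k\<close> to the central exponent, hence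
    \<open>p * k\<close> to the height, which is the length they add.\<close>
  have "steps N ([], 0) w = steps N ([], 0) (w0 @ replicate (N GenX * k) (GenX, e))"
    by (rule E_steps[OF deletion_E[OF del]])
  also have "\<dots> = run N GenX (int (N GenX) * (sg e * int k)) (steps N ([], 0) w0)"
    using steps_replicate[OF val, of "N GenX * k" GenX e] by (simp add: algebra_simps)
  also have "\<dots> = (fst (steps N ([], 0) w0), snd (steps N ([], 0) w0) + sg e * int k)"
    using val N_x by (intro run_order) simp_all
  finally have "height N \<kappa> (steps N ([], 0) w) = height N \<kappa> (steps N ([], 0) w0) + \<kappa> * sg e * int k"
    by (simp add: height_def algebra_simps)
  moreover have "\<kappa> * sg e * int k = p * int k"
    using \<kappa>(2) by (auto simp: sg_def)
  ultimately have "height N \<kappa> (steps N ([], 0) w) = int (length w)"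
    using tight deletion_length[OF del] by (simp add: p_def)
  moreover have "height N \<kappa> (steps N ([], 0) v) \<le> height N \<kappa> ([], 0) + int (length v)"
    by (rule height_steps[OF _ slope]) simp
  moreover have "steps N ([], 0) v = steps N ([], 0) w"
    by (rule E_steps[OF assms(1)])
  ultimately show False using assms(2) by (simp add: height_def)
qed

end

section \<open>Dihedral Artin groups\<close>

definition subst_word :: "('s \<Rightarrow> 't letter list) \<Rightarrow> 's letter list \<Rightarrow> 't letter list" where
  "subst_word f u = concat (map (\<lambda>(s, e). if e then f s else inv_word (f s)) u)"

lemma subst_Nil [simp]: "subst_word f [] = []"
  and subst_Cons: "subst_word f ((s, e) # u) = (if e then f s else inv_word (f s)) @ subst_word f u"
  and subst_append [simp]: "subst_word f (u @ v) = subst_word f u @ subst_word f v"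
  by (simp_all add: subst_word_def)

lemma subst_inv_word: "subst_word f (inv_word u) = inv_word (subst_word f u)"
proof (induction u)
  case (Cons l u)
  have "inv_word (l # u) = inv_word u @ [(fst l, \<not> snd l)]"
    by (simp add: inv_word_def case_prod_beta)
  with Cons show ?case
    by (cases l) (simp add: subst_Cons inv_word_append)
qed simp

lemma subst_replicate_True: "subst_word f (replicate n (s, True)) = concat (replicate n (f s))"
  by (induction n) (simp_all add: subst_Cons)

text \<open>The action on states, pulled back along \<tau>, respects the relations and so descends
  to the presented group.\<close>

lemma steps_pres_eq:
  assumes "pres_eq R u v" "valid N (fst S)"
    and "\<And>u v S. (u, v) \<in> R \<Longrightarrow> valid N (fst S) \<Longrightarrow> steps N S (subst_word \<tau> u) = steps N S (subst_word \<tau> v)"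
  shows "steps N S (subst_word \<tau> u) = steps N S (subst_word \<tau> v)"
  using assms(1,2)
proof (induction arbitrary: S rule: pres_eq.induct)
  case (cong u u' v v')
  then show ?case by (simp add: valid_steps)
next
  case (cancel s e)
  have "subst_word \<tau> [(s, e), (s, \<not> e)] = subst_word \<tau> [(s, e)] @ inv_word (subst_word \<tau> [(s, e)])"
    by (simp add: subst_Cons)
  then show ?case using cancel by (simp only: steps_inv_word) simp
next
  case (rel u v)
  then show ?case by (rule assms(3))
qed simp_all

text \<open>On states \<tau> undoes \<rho>, so the invariant can be read off directly from words in
  x and y.\<close>

lemma steps_subst_subst:
  assumes gen: "\<And>g S. valid N (fst S) \<Longrightarrow> steps N S (subst_word \<tau> (\<rho> g)) = run N g 1 S"
    and "valid N (fst S)"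
  shows "steps N S (subst_word \<tau> (subst_word \<rho> u)) = steps N S u"
  using assms(2)
proof (induction u arbitrary: S)
  case (Cons l u)
  obtain g e where l: "l = (g, e)" by (cases l)
  have "steps N S (subst_word \<tau> (subst_word \<rho> [l])) = step N S l"
  proof (cases e)
    case True
    then show ?thesis using gen[OF Cons.prems] by (simp add: l subst_Cons step_def sg_def)
  next
    case False
    let ?S = "run N g (- 1) S"
    have v: "valid N (fst ?S)" using Cons.prems by (rule valid_run)
    have "steps N ?S (subst_word \<tau> (\<rho> g)) = S"
      using gen[OF v] Cons.prems by (simp add: run_run run_0)
    with steps_inv_word[OF v, of "subst_word \<tau> (\<rho> g)"] False show ?thesis
      by (simp add: l subst_Cons subst_inv_word step_def sg_def)
  qed
  moreover have "subst_word \<rho> (l # u) = subst_word \<rho> [l] @ subst_word \<rho> u"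
    by (simp add: l subst_Cons)
  moreover have "valid N (fst (step N S l))"
    unfolding step_def using Cons.prems by (rule valid_run)
  ultimately show ?case using Cons.IH by simp
qed simp

text \<open>\<rho> writes x and y in the given generators, \<tau> writes these in x and y. Words in
  group elements are lifted to letter words along \<open>el\<close>, where
  \<open>central_power\<close> applies.\<close>

lemma fftp_presented_group:
  fixes \<rho> :: "xy \<Rightarrow> 's letter list" and \<tau> :: "'s \<Rightarrow> xy letter list"
  assumes N: "2 \<le> N GenX" "N GenY = 0 \<or> N GenX < N GenY"
    and central: "pres_eq R (subst_word \<rho> (replicate (N GenX) (GenX, True) @ [(GenY, True)]))
      (subst_word \<rho> ([(GenY, True)] @ replicate (N GenX) (GenX, True)))"
    and power: "N GenY \<noteq> 0 \<Longrightarrow> pres_eq R (subst_word \<rho> (replicate (N GenY) (GenY, True)))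
      (subst_word \<rho> (replicate (N GenX) (GenX, True)))"
    and rel: "\<And>u v S. (u, v) \<in> R \<Longrightarrow> valid N (fst S) \<Longrightarrow> steps N S (subst_word \<tau> u) = steps N S (subst_word \<tau> v)"
    and gen: "\<And>g S. valid N (fst S) \<Longrightarrow> steps N S (subst_word \<tau> (\<rho> g)) = run N g 1 S"
  shows "fftp (presented_group R) {pres_class R (\<rho> GenX), pres_class R (\<rho> GenY)}"
proof -
  define E where "E u v \<longleftrightarrow> pres_eq R (subst_word \<rho> u) (subst_word \<rho> v)" for u v
  interpret central_power N E
  proof
    show "2 \<le> N GenX" "N GenY = 0 \<or> N GenX < N GenY" by (fact N)+
    show "E u u" for u by (simp add: E_def pres_eq.refl)
    show "E v u" if "E u v" for u v using that unfolding E_def by (rule pres_eq.sym)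
    show "E u w" if "E u v" "E v w" for u v w using that unfolding E_def by (rule pres_eq.trans)
    show "E (u @ v) (u' @ v')" if "E u u'" "E v v'" for u u' v v'
      using that unfolding E_def subst_append by (rule pres_eq.cong)
    show "E [(g, s), (g, \<not> s)] []" for g s
    proof -
      have "pres_eq R (inv_word (inv_word (subst_word \<rho> [(g, s)])) @ inv_word (subst_word \<rho> [(g, s)])) []"
        by (rule pres_eq_inv_word)
      then show ?thesis by (cases s) (simp_all add: E_def subst_Cons)
    qed
    show "E (replicate (N GenX) (GenX, True) @ [(GenY, True)])
      ([(GenY, True)] @ replicate (N GenX) (GenX, True))"
      unfolding E_def by (fact central)
    show "E (replicate (N GenY) (GenY, True)) (replicate (N GenX) (GenX, True))" if "N GenY \<noteq> 0"
      unfolding E_def using that by (rule power)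
    show "steps N ([], 0) u = steps N ([], 0) v" if "E u v" for u v
    proof -
      have val: "valid N (fst ([], 0))" by simp
      have "steps N ([], 0) (subst_word \<tau> (subst_word \<rho> u)) = steps N ([], 0) (subst_word \<tau> (subst_word \<rho> v))"
        by (rule steps_pres_eq[OF that[unfolded E_def] val rel])
      then show ?thesis by (simp only: steps_subst_subst[OF gen val])
    qed
  qed
  define X where "X = {pres_class R (\<rho> GenX), pres_class R (\<rho> GenY)}"
  let ?G = "presented_group R"
  interpret G: group ?G by (rule group_presented_group)
  define el where "el l = pres_class R (subst_word \<rho> [l])" for l
  have X: "X \<union> m_inv ?G ` X = range el"
  proof -
    have "(UNIV :: xy letter set) = {(GenX, True), (GenX, False), (GenY, True), (GenY, False)}"
    proof (rule UNIV_eq_I)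
      fix l :: "xy letter"
      show "l \<in> {(GenX, True), (GenX, False), (GenY, True), (GenY, False)}"
        by (cases l; cases "fst l"; cases "snd l") simp_all
    qed
    then have "range el = el ` {(GenX, True), (GenX, False), (GenY, True), (GenY, False)}"
      by simp
    also have "\<dots> = X \<union> m_inv ?G ` X"
      by (auto simp: X_def el_def subst_Cons pres_class_inv)
    finally show ?thesis ..
  qed
  have over: "words_over ?G X = range (map el)"
    by (simp add: words_over_def X lists_image lists_UNIV)
  have eval: "word_eval ?G (map el W) = pres_class R (subst_word \<rho> W)" for W
  proof (induction W)
    case (Cons l W)
    then show ?case
      by (cases l) (simp add: word_eval_def el_def pres_class_mult subst_Cons)
  qed (simp add: word_eval_def pres_class_one)
  have len: "word_length ?G X (pres_class R (subst_word \<rho> W)) \<le> length W" for W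
    unfolding word_length_def over
    by (rule Least_le, rule bexI[of _ "map el W"]) (simp_all add: eval)
  have "\<exists>w'\<in>words_over ?G X. length w' < length w \<and> word_eval ?G w' = word_eval ?G w
      \<and> fellow_travel ?G X (42 * width) w w'"
    if w: "w \<in> words_over ?G X" "\<not> geodesic_word ?G X w" for w
  proof -
    obtain W where W: "w = map el W" using w(1) over by auto
    let ?P = "\<lambda>n. \<exists>v\<in>words_over ?G X. word_eval ?G v = word_eval ?G w \<and> length v = n"
    have "?P (length w)" using w(1) by blast
    then have "?P (Least ?P)" by (rule LeastI)
    then obtain v where "v \<in> words_over ?G X" "word_eval ?G v = word_eval ?G w"
      "length v = word_length ?G X (word_eval ?G w)"
      unfolding word_length_def by blast
    moreover have "word_length ?G X (word_eval ?G w) \<le> length w"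
      using len[of W] by (simp add: W eval)
    moreover have "length w \<noteq> word_length ?G X (word_eval ?G w)"
      using w by (simp add: geodesic_word_def)
    ultimately obtain V where "word_eval ?G (map el V) = word_eval ?G w" "length V < length w"
      using over by fastforce
    then have "E V W" "length V < length W"
      by (simp_all add: W eval E_def pres_class_eq_iff)
    then have "shortenable W" by (rule nongeodesic_shortenable)
    then obtain z W' where sh: "shift (42 * width) z W W'" and z: "E z []" and lt: "length W' < length W"
      by (auto simp: shortenable_def)
    have "E W' W"
      using sh E_left[OF z, of W] by (auto simp: shift_def intro: E_trans)
    then have ev: "word_eval ?G (map el W') = word_eval ?G w"
      by (simp add: W eval E_def pres_class_eq_iff)
    have "word_length ?G X (inv\<^bsub>?G\<^esub> (word_eval ?G (take i w)) \<otimes>\<^bsub>?G\<^esub> word_eval ?G (take i (map el W')))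
        \<le> 42 * width" for i
    proof -
      have "near (42 * width) (take i W) (take i W')" using sh by (simp add: shift_def)
      then obtain V where V: "length V \<le> 42 * width" "E (take i W @ V) (take i W')"
        by (auto simp: near_def)
      have "pres_class R (subst_word \<rho> (take i W')) =
          pres_class R (subst_word \<rho> (take i W)) \<otimes>\<^bsub>?G\<^esub> pres_class R (subst_word \<rho> V)"
        using E_sym[OF V(2)] by (simp add: E_def pres_class_mult pres_class_eq_iff)
      then have "inv\<^bsub>?G\<^esub> (word_eval ?G (take i w)) \<otimes>\<^bsub>?G\<^esub> word_eval ?G (take i (map el W'))
          = pres_class R (subst_word \<rho> V)"
        by (simp add: W take_map eval G.m_assoc[symmetric])
      with len[of V] V(1) show ?thesis by simp
    qed
    with ev lt over show ?thesis
      by (intro bexI[of _ "map el W'"]) (auto simp: fellow_travel_def W)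
  qed
  then show ?thesis unfolding fftp_def X_def by blast
qed

section \<open>Generators and relations in the two parities\<close>

lemma alternating_add:
  "alternating (i + j) s t = alternating i s t @ (if even i then alternating j s t else alternating j t s)"
  by (induction i arbitrary: s t) simp_all

lemma alternating_even: "alternating (2 * n) s t = concat (replicate n [s, t])"
  by (induction n) simp_all

lemma fftp_dihedral_artin_odd:
  assumes m: "m = Suc (2 * k)" "0 < k"
  shows "fftp (dihedral_artin m) (free_product_gens m)"
proof -
  define N where "N g = (case g of GenX \<Rightarrow> 2 | GenY \<Rightarrow> m)" for g
  define \<rho> where "\<rho> g = (case g of GenX \<Rightarrow> alternating m letter_a letter_b
    | GenY \<Rightarrow> [letter_a, letter_b])" for g
  \<comment> \<open>From x = y^k a and y = ab: a = y^-k x and b = x^-1 y^(k+1).\<close>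
  define \<tau> where "\<tau> s = (case s of GenA \<Rightarrow> replicate k (GenY, False) @ [(GenX, True)]
    | GenB \<Rightarrow> (GenX, False) # replicate (Suc k) (GenY, True))" for s
  let ?R = "artin_relations m"
  have rel: "pres_eq ?R (alternating m letter_a letter_b) (alternating m letter_b letter_a)"
    by (rule pres_eq.rel) (simp add: artin_relations_def)
  \<comment> \<open>As m is odd, (ab)^m splits into the two alternating words of length m, both
    equal to x.\<close>
  have "subst_word \<rho> (replicate m (GenY, True)) = alternating (m + m) letter_a letter_b"
    by (simp add: subst_replicate_True \<rho>_def alternating_even[symmetric] mult_2)
  also have "\<dots> = alternating m letter_a letter_b @ alternating m letter_b letter_a"
    by (simp only: alternating_add m(1)) simp
  finally have pow: "pres_eq ?R (subst_word \<rho> (replicate m (GenY, True))) (subst_word \<rho> (replicate 2 (GenX, True)))"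
    using pres_eq.cong[OF pres_eq.refl pres_eq.sym[OF rel]]
    by (simp add: subst_replicate_True \<rho>_def numeral_2_eq_2 subst_Cons)
  have a: "steps N S (subst_word \<tau> [letter_a]) = run N GenX 1 (run N GenY (- int k) S)"
    and b: "steps N S (subst_word \<tau> [letter_b]) = run N GenY (int k + 1) (run N GenX (- 1) S)"
    if "valid N (fst S)" for S
    using steps_replicate[of N S k GenY False] that
      steps_replicate[of N "run N GenX (- 1) S" "Suc k" GenY True]
    by (simp_all add: subst_Cons \<tau>_def steps_snoc valid_run step_def[of N _ "(_, _)"] sg_def add.commute del: replicate_Suc)
  have ab: "steps N S (subst_word \<tau> [letter_a, letter_b]) = run N GenY 1 S" if "valid N (fst S)" for S
  proof -
    have "steps N S (subst_word \<tau> ([letter_a] @ [letter_b])) = run N GenY 1 S"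
      unfolding subst_append foldl_append using that by (simp add: a b valid_run run_run run_0)
    then show ?thesis by simp
  qed
  have abs: "steps N S (subst_word \<tau> (alternating (2 * n) letter_a letter_b)) = run N GenY (int n) S"
    if "valid N (fst S)" for S n
    using that
  proof (induction n arbitrary: S)
    case (Suc n)
    have "alternating (2 * Suc n) letter_a letter_b = [letter_a, letter_b] @ alternating (2 * n) letter_a letter_b"
      by simp
    then show ?case
      using Suc by (simp only: subst_append foldl_append ab valid_run run_run) (simp add: add.commute)
  qed (simp add: run_0)
  have x: "steps N S (subst_word \<tau> (alternating m letter_a letter_b)) = run N GenX 1 S"
    if "valid N (fst S)" for S
  proof -
    have "alternating m letter_a letter_b = alternating (2 * k) letter_a letter_b @ [letter_a]"
      using alternating_add[of "2 * k" 1 letter_a letter_b] by (simp add: m)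
    with that show ?thesis
      by (simp only: subst_append foldl_append abs a valid_run) (simp add: run_run run_0)
  qed
  have x': "steps N S (subst_word \<tau> (alternating m letter_b letter_a)) = run N GenX 1 S"
    if "valid N (fst S)" for S
  proof -
    let ?S = "run N GenX (- 1) S"
    have v: "valid N (fst ?S)" using that by (rule valid_run)
    have "alternating m letter_b letter_a = [letter_b] @ alternating (2 * k) letter_a letter_b"
      by (simp add: m)
    with that have "steps N S (subst_word \<tau> (alternating m letter_b letter_a)) = run N GenY (int m) ?S"
      by (simp only: subst_append foldl_append abs b valid_run) (simp add: run_run valid_run m algebra_simps)
    \<comment> \<open>On states, y^m and x^2 both add 1 to the central exponent.\<close>
    also have "\<dots> = run N GenX 2 ?S"
      using run_order[OF v, of GenX 1] run_order[OF v, of GenY 1] by (simp add: N_def m)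
    also have "\<dots> = run N GenX 1 S" using that by (simp add: run_run)
    finally show ?thesis .
  qed
  have "fftp (presented_group ?R) {pres_class ?R (\<rho> GenX), pres_class ?R (\<rho> GenY)}"
  proof (rule fftp_presented_group[of N ?R \<rho> \<tau>])
    have "pres_eq ?R (subst_word \<rho> (replicate 2 (GenX, True)) @ subst_word \<rho> [(GenY, True)])
        (subst_word \<rho> (replicate m (GenY, True)) @ subst_word \<rho> [(GenY, True)])"
      by (rule pres_eq.cong[OF pres_eq.sym[OF pow] pres_eq.refl])
    also have "subst_word \<rho> (replicate m (GenY, True)) @ subst_word \<rho> [(GenY, True)]
        = subst_word \<rho> [(GenY, True)] @ subst_word \<rho> (replicate m (GenY, True))"
      unfolding subst_append[symmetric] by (simp add: replicate_append_same)
    finally have "pres_eq ?R (subst_word \<rho> (replicate 2 (GenX, True)) @ subst_word \<rho> [(GenY, True)])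
        (subst_word \<rho> [(GenY, True)] @ subst_word \<rho> (replicate 2 (GenX, True)))"
      by (rule pres_eq.trans[OF _ pres_eq.cong[OF pres_eq.refl pow]])
    then show "pres_eq ?R (subst_word \<rho> (replicate (N GenX) (GenX, True) @ [(GenY, True)]))
      (subst_word \<rho> ([(GenY, True)] @ replicate (N GenX) (GenX, True)))"
      by (simp only: N_def xy.case subst_append)
  next
    show "steps N S (subst_word \<tau> (\<rho> g)) = run N g 1 S" if "valid N (fst S)" for g S
      using x[OF that] ab[OF that] by (cases g) (simp_all add: \<rho>_def)
  qed (use m pow x x' in \<open>auto simp: N_def artin_relations_def\<close>)
  then show ?thesis
    using m by (simp add: \<rho>_def dihedral_artin_def free_product_gens_def gen_x_def gen_y_def)
qed

lemma fftp_dihedral_artin_even: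
  assumes m: "m = 2 * p" "2 \<le> p"
  shows "fftp (dihedral_artin m) (free_product_gens m)"
proof -
  define N where "N g = (case g of GenX \<Rightarrow> p | GenY \<Rightarrow> 0)" for g
  define \<rho> where "\<rho> g = (case g of GenX \<Rightarrow> [letter_a, letter_b] | GenY \<Rightarrow> [letter_a])" for g
  \<comment> \<open>From y = a and x = ab: b = y^-1 x.\<close>
  define \<tau> where "\<tau> s = (case s of GenA \<Rightarrow> [(GenY, True)]
    | GenB \<Rightarrow> [(GenY, False), (GenX, True)])" for s
  let ?R = "artin_relations m"
  have rel: "pres_eq ?R (alternating m letter_a letter_b) (alternating m letter_b letter_a)"
    by (rule pres_eq.rel) (simp add: artin_relations_def)
  have xp: "subst_word \<rho> (replicate p (GenX, True)) = alternating m letter_a letter_b"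
    by (simp add: subst_replicate_True \<rho>_def alternating_even m)
  have a: "steps N S (subst_word \<tau> [letter_a]) = run N GenY 1 S"
    and b: "steps N S (subst_word \<tau> [letter_b]) = run N GenX 1 (run N GenY (- 1) S)" for S
    by (simp_all add: subst_Cons \<tau>_def step_def sg_def)
  have ab: "steps N S (subst_word \<tau> [letter_a, letter_b]) = run N GenX 1 S" if "valid N (fst S)" for S
  proof -
    have "steps N S (subst_word \<tau> ([letter_a] @ [letter_b])) = run N GenX 1 S"
      unfolding subst_append foldl_append using that by (simp add: a b valid_run run_run run_0)
    then show ?thesis by simp
  qed
  have abs: "steps N S (subst_word \<tau> (alternating (2 * n) letter_a letter_b)) = run N GenX (int n) S"
    if "valid N (fst S)" for S n
    using that
  proof (induction n arbitrary: S)
    case (Suc n)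
    have "alternating (2 * Suc n) letter_a letter_b = [letter_a, letter_b] @ alternating (2 * n) letter_a letter_b"
      by simp
    then show ?case
      using Suc by (simp only: subst_append foldl_append ab valid_run run_run) (simp add: add.commute)
  qed (simp add: run_0)
  have xp_run: "run N GenX (int p) S = (fst S, snd S + 1)" if "valid N (fst S)" for S
    using run_order[OF that, of GenX 1] m by (simp add: N_def)
  have ba: "steps N S (subst_word \<tau> (alternating m letter_b letter_a)) = (fst S, snd S + 1)"
    if "valid N (fst S)" for S
  proof -
    obtain q where q: "p = Suc q" using m(2) by (cases p) auto
    let ?S = "run N GenY (- 1) S"
    have v: "valid N (fst ?S)" using that by (rule valid_run)
    \<comment> \<open>The word is b (ab)^(p-1) a, which acts as y^-1 x^p y.\<close>
    have "alternating m letter_b letter_a = [letter_b] @ alternating (2 * q) letter_a letter_b @ [letter_a]"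
      using alternating_add[of "2 * q" 1 letter_a letter_b] by (simp add: m q)
    with v have "steps N S (subst_word \<tau> (alternating m letter_b letter_a)) = run N GenY 1 (run N GenX (int p) ?S)"
      by (simp only: subst_append foldl_append abs a b valid_run run_run) (simp add: q)
    also have "\<dots> = run N GenY 1 (fst ?S, snd ?S + 1)"
      by (simp add: xp_run v)
    also have "\<dots> = (fst S, snd S + 1)"
      using that by (simp add: run_shift run_run run_0)
    finally show ?thesis .
  qed
  have "fftp (presented_group ?R) {pres_class ?R (\<rho> GenX), pres_class ?R (\<rho> GenY)}"
  proof (rule fftp_presented_group[of N ?R \<rho> \<tau>])
    \<comment> \<open>Centrality of x^p comes from shifting the alternating word by one letter: x^p
      y is y times the other alternating word.\<close>
    have "alternating m letter_a letter_b @ [letter_a] = alternating (m + 1) letter_a letter_b"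
      using m by (simp only: alternating_add) simp
    also have "\<dots> = [letter_a] @ alternating m letter_b letter_a" by simp
    finally have "pres_eq ?R (alternating m letter_a letter_b @ [letter_a])
        ([letter_a] @ alternating m letter_a letter_b)"
      using pres_eq.cong[OF pres_eq.refl pres_eq.sym[OF rel], of "[letter_a]"] by simp
    then show "pres_eq ?R (subst_word \<rho> (replicate (N GenX) (GenX, True) @ [(GenY, True)]))
      (subst_word \<rho> ([(GenY, True)] @ replicate (N GenX) (GenX, True)))"
      by (simp add: N_def xp subst_Cons) (simp add: \<rho>_def)
  next
    show "steps N S (subst_word \<tau> (\<rho> g)) = run N g 1 S" if "valid N (fst S)" for g S
      using ab[OF that] a by (cases g) (simp_all add: \<rho>_def)
  next
    show "steps N S (subst_word \<tau> u) = steps N S (subst_word \<tau> v)"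
      if "(u, v) \<in> ?R" "valid N (fst S)" for u v S
      using that abs[OF that(2), of p] ba[OF that(2)] xp_run[OF that(2)]
      by (simp add: artin_relations_def m)
  qed (use m in \<open>auto simp: N_def\<close>)
  then show ?thesis
    using m by (simp add: \<rho>_def dihedral_artin_def free_product_gens_def gen_x_def gen_y_def)
qed

theorem theorem6p5:
  fixes m :: nat
  assumes "m \<ge> 3"
  shows "fftp (dihedral_artin m) (free_product_gens m)"
proof (cases "odd m")
  case True
  then obtain k where "m = Suc (2 * k)" by (metis oddE Suc_eq_plus1)
  with assms show ?thesis by (intro fftp_dihedral_artin_odd[of m k]) linarith+
next
  case False
  then obtain p where "m = 2 * p" by blast
  with assms show ?thesis by (intro fftp_dihedral_artin_even[of m p]) linarith+
qed

end
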